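(* Let $I=\{1,2,\ldots,n\}$, let $\mathfrak g$ be the simple Lie algebra of type $A_n$, and let $m$ be a dominant monomial in the variables $Y_{i,r}$ ($i\in I$, $r\in\mathbb Z$). The simple $U_q(\widehat{\mathfrak g})$-module $L(m)$ is a Hernandez-Leclerc module corresponding to a cluster variable (frozen variables excluded), for some height function $\xi:I\to\mathbb Z$, if and only if $$m=Y_{i_1,a_1}Y_{i_2,a_2}\cdots Y_{i_k,a_k}$$ for some $k\in\mathbb Z_{\ge 1}$, $i_1,\dots,i_k\in I$ and $a_1,\dots,a_k\in\mathbb Z$ such that (i) $i_1<i_2<\cdots<i_k$; (ii) $(a_j-a_{j-1})(a_{j+1}-a_j)<0$ for $2\le j\le k-1$; (iii) $|a_j-a_{j-1}|=i_j-i_{j-1}+2$ for $2\le j\le k$.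
   Context: $q\in\mathbb C^\times$ is not a root of unity and $U_q(\widehat{\mathfrak g})$ is the untwisted quantum affine algebra of type $A_n$. Fix $a\in\mathbb C^\times$ and write $Y_{i,r}$ for $Y_{i,aq^r}$. A dominant monomial is a monomial with nonnegative exponents in the $Y_{i,r}$; finite-dimensional simple modules considered here are $L(m)$, where the dominant monomial $m$ is the highest $\ell$-weight monomial of $L(m)$. A height function is a map $\xi:I\to\mathbb Z$ with $|\xi(i)-\xi(i+1)|=1$ for $1\le i\le n-1$. For $1\le i<j\le n$, let $i_2<\cdots<i_{k-1}$ be the ordered enumeration of $\{p: i<p<j,\ \xi(p-1)=\xi(p+1)\}$, and put $i_1=i$, $i_k=j$. Define $$\omega(i,j)=Y_{i_1,a_1}Y_{i_2,a_2}\cdots Y_{i_k,a_k},$$ where $a_1=\xi(i)\pm1$ if $\xi(i+1)=\xi(i)\mp1$, and for $\ell\ge2$, $a_\ell=\xi(i_\ell)\pm1$ if $\xi(i_\ell)=\xi(i_\ell-1)\pm1$. Put $$\mathbf{Pr}_\xi=\{Y_{i,\xi(i)\pm1}: i\in I\}\cup\{\omega(i,j):1\le i<j\le n\},\qquad \mathbf f=\{f_i=Y_{i,\xi(i)-1}Y_{i,\xi(i)+1}: i\in I\}.$$ The Hernandez-Leclerc modules attached to $\xi$ are the simple modules $L(m)$ with $m\in\mathbf{Pr}_\xi\cup\mathbf f$. By Brito and Chari, these correspond bijectively to the cluster variables and frozen variables of a certain cluster algebra $\mathcal A(\widetilde{\mathbf x},Q_\xi)$ of type $A_n$; the ones corresponding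 to cluster variables are those with $m\in\mathbf{Pr}_\xi$, and the ones corresponding to frozen variables are those with $m\in\mathbf f$. *)

theory Defs
  imports
    "HOL-Library.Multiset"
    "HOL-Computational_Algebra.Computational_Algebra"
begin

section \<open>Modules over the quantum affine algebra of type A\<close>

text \<open>
  A module over \<open>U_q(g^)\<close>, \<open>g\<close> of type \<open>A_n\<close>, is a complex vector space with operators for the
  generators of Drinfeld's (second) realization satisfying its defining relations. The operators
  are, for \<open>i \<in> {1..n}\<close> and \<open>\<epsilon> \<in> {1, -1}\<close>:
  \<^item> \<open>x_op V \<epsilon> i r\<close>: the generator \<open>x^\<plusminus>_{i,r}\<close> with sign \<open>\<epsilon>\<close>, for integer \<open>r\<close>;
  \<^item> \<open>k_op V i s\<close>: the power \<open>K_i^s\<close>, for integer \<open>s\<close>;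
  \<^item> \<open>h_op V i r\<close>: the generator \<open>h_{i,r}\<close>, for integer \<open>r \<noteq> 0\<close> (the value at \<open>r = 0\<close> is never used);
  \<^item> \<open>c_op V s\<close>: the power \<open>c^{s/2}\<close> of the central generator \<open>c^{1/2}\<close>, for integer \<open>s\<close>.
\<close>

record 'v uq_operators =
  vscale :: "complex \<Rightarrow> 'v \<Rightarrow> 'v"
  x_op :: "int \<Rightarrow> nat \<Rightarrow> int \<Rightarrow> 'v \<Rightarrow> 'v"
  k_op :: "nat \<Rightarrow> int \<Rightarrow> 'v \<Rightarrow> 'v"
  h_op :: "nat \<Rightarrow> int \<Rightarrow> 'v \<Rightarrow> 'v"
  c_op :: "int \<Rightarrow> 'v \<Rightarrow> 'v"

definition cartan :: "nat \<Rightarrow> nat \<Rightarrow> int" where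
  "cartan i j = (if i = j then 2 else if i = j + 1 \<or> j = i + 1 then -1 else 0)"

definition qint :: "complex \<Rightarrow> int \<Rightarrow> complex" where
  "qint q s = (q powi s - q powi (- s)) / (q - inverse q)"

definition compositions :: "nat \<Rightarrow> nat list set" where
  "compositions r = {ss. sum_list ss = r \<and> (\<forall>s\<in>set ss. 0 < s)}"

text \<open>
  The operators \<open>\<phi>^\<plusminus>_{i,r}\<close> are the coefficients of
  \<open>\<Sum>_{r \<ge> 0} \<phi>^\<plusminus>_{i,\<plusminus>r} u^{\<plusminus>r} = K_i^{\<plusminus>1} exp (\<plusminus>(q - q^{-1}) \<Sum>_{s \<ge> 1} h_{i,\<plusminus>s} u^{\<plusminus>s})\<close>.
  The exponential is expanded term by term: its \<open>k\<close>-th summand contributes to \<open>u^{\<plusminus>r}\<close> one product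
  \<open>h_{i,\<plusminus>s_1} \<dots> h_{i,\<plusminus>s_k}\<close> for each composition \<open>r = s_1 + \<dots> + s_k\<close>.
\<close>

definition phi_op ::
  "complex \<Rightarrow> ('v::ab_group_add) uq_operators \<Rightarrow> int \<Rightarrow> nat \<Rightarrow> int \<Rightarrow> 'v \<Rightarrow> 'v" where
  "phi_op q V \<epsilon> i r v =
     (if \<epsilon> * r < 0 then 0
      else k_op V i \<epsilon>
        (\<Sum>ss\<in>compositions (nat (\<epsilon> * r)).
           vscale V ((of_int \<epsilon> * (q - inverse q)) ^ length ss / fact (length ss))
             (foldr (\<lambda>s. h_op V i (\<epsilon> * int s)) ss v)))"

locale uq_affine_module = vector_space "vscale V"
  for V :: "('v::ab_group_add) uq_operators" +
  fixes n :: nat and q :: complex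
  assumes x_linear:
    "\<lbrakk>\<epsilon> \<in> {1, -1}; i \<in> {1..n}\<rbrakk> \<Longrightarrow> Vector_Spaces.linear (vscale V) (vscale V) (x_op V \<epsilon> i r)"
  and k_linear:
    "i \<in> {1..n} \<Longrightarrow> Vector_Spaces.linear (vscale V) (vscale V) (k_op V i s)"
  and h_linear:
    "\<lbrakk>i \<in> {1..n}; r \<noteq> 0\<rbrakk> \<Longrightarrow> Vector_Spaces.linear (vscale V) (vscale V) (h_op V i r)"
  and c_linear: "Vector_Spaces.linear (vscale V) (vscale V) (c_op V s)"
  and c_zero: "c_op V 0 v = v"
  and c_add: "c_op V (s + t) v = c_op V s (c_op V t v)"
  and c_x: "\<lbrakk>\<epsilon> \<in> {1, -1}; i \<in> {1..n}\<rbrakk>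
    \<Longrightarrow> c_op V s (x_op V \<epsilon> i r v) = x_op V \<epsilon> i r (c_op V s v)"
  and c_k: "i \<in> {1..n} \<Longrightarrow> c_op V s (k_op V i t v) = k_op V i t (c_op V s v)"
  and c_h: "\<lbrakk>i \<in> {1..n}; r \<noteq> 0\<rbrakk> \<Longrightarrow> c_op V s (h_op V i r v) = h_op V i r (c_op V s v)"
  and k_zero: "i \<in> {1..n} \<Longrightarrow> k_op V i 0 v = v"
  and k_add: "i \<in> {1..n} \<Longrightarrow> k_op V i (s + t) v = k_op V i s (k_op V i t v)"
  and k_k: "\<lbrakk>i \<in> {1..n}; j \<in> {1..n}\<rbrakk> \<Longrightarrow> k_op V i s (k_op V j t v) = k_op V j t (k_op V i s v)"
  and k_h: "\<lbrakk>i \<in> {1..n}; j \<in> {1..n}; r \<noteq> 0\<rbrakk>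
    \<Longrightarrow> k_op V i s (h_op V j r v) = h_op V j r (k_op V i s v)"
  and k_x: "\<lbrakk>\<epsilon> \<in> {1, -1}; i \<in> {1..n}; j \<in> {1..n}\<rbrakk>
    \<Longrightarrow> k_op V i 1 (x_op V \<epsilon> j r (k_op V i (-1) v))
        = vscale V (q powi (\<epsilon> * cartan i j)) (x_op V \<epsilon> j r v)"
  and h_h: "\<lbrakk>i \<in> {1..n}; j \<in> {1..n}; r \<noteq> 0; s \<noteq> 0\<rbrakk>
    \<Longrightarrow> h_op V i r (h_op V j s v) - h_op V j s (h_op V i r v)
        = (if r + s = 0
           then vscale V (qint q (r * cartan i j) / of_int r / (q - inverse q))
                  (c_op V (2 * r) v - c_op V (- 2 * r) v)
           else 0)"
  and h_x: "\<lbrakk>\<epsilon> \<in> {1, -1}; i \<in> {1..n}; j \<in> {1..n}; r \<noteq> 0\<rbrakk>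
    \<Longrightarrow> h_op V i r (x_op V \<epsilon> j s v) - x_op V \<epsilon> j s (h_op V i r v)
        = vscale V (of_int \<epsilon> * qint q (r * cartan i j) / of_int r)
            (c_op V (- \<epsilon> * \<bar>r\<bar>) (x_op V \<epsilon> j (r + s) v))"
  and x_x: "\<lbrakk>\<epsilon> \<in> {1, -1}; i \<in> {1..n}; j \<in> {1..n}\<rbrakk>
    \<Longrightarrow> x_op V \<epsilon> i (r + 1) (x_op V \<epsilon> j s v)
          - vscale V (q powi (\<epsilon> * cartan i j)) (x_op V \<epsilon> j s (x_op V \<epsilon> i (r + 1) v))
        = vscale V (q powi (\<epsilon> * cartan i j)) (x_op V \<epsilon> i r (x_op V \<epsilon> j (s + 1) v))
          - x_op V \<epsilon> j (s + 1) (x_op V \<epsilon> i r v)"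
  and xp_xm: "\<lbrakk>i \<in> {1..n}; j \<in> {1..n}\<rbrakk>
    \<Longrightarrow> x_op V 1 i r (x_op V (-1) j s v) - x_op V (-1) j s (x_op V 1 i r v)
        = (if i = j
           then vscale V (1 / (q - inverse q))
                  (c_op V (r - s) (phi_op q V 1 i (r + s) v)
                   - c_op V (s - r) (phi_op q V (-1) i (r + s) v))
           else 0)"
  and serre_0: "\<lbrakk>\<epsilon> \<in> {1, -1}; i \<in> {1..n}; j \<in> {1..n}; cartan i j = 0\<rbrakk>
    \<Longrightarrow> x_op V \<epsilon> i r (x_op V \<epsilon> j s v) = x_op V \<epsilon> j s (x_op V \<epsilon> i r v)"
  and serre_1: "\<lbrakk>\<epsilon> \<in> {1, -1}; i \<in> {1..n}; j \<in> {1..n}; cartan i j = -1\<rbrakk>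
    \<Longrightarrow> (\<Sum>(r, r')\<leftarrow>[(r\<^sub>1, r\<^sub>2), (r\<^sub>2, r\<^sub>1)].
           x_op V \<epsilon> i r (x_op V \<epsilon> i r' (x_op V \<epsilon> j s v))
           - vscale V (q + inverse q) (x_op V \<epsilon> i r (x_op V \<epsilon> j s (x_op V \<epsilon> i r' v)))
           + x_op V \<epsilon> j s (x_op V \<epsilon> i r (x_op V \<epsilon> i r' v))) = 0"
begin

definition submodule :: "'v set \<Rightarrow> bool" where
  "submodule W \<longleftrightarrow> subspace W \<and>
     (\<forall>v\<in>W. (\<forall>s. c_op V s v \<in> W) \<and>
       (\<forall>i\<in>{1..n}. (\<forall>\<epsilon>\<in>{1, -1}. \<forall>r. x_op V \<epsilon> i r v \<in> W) \<and>
                    (\<forall>s. k_op V i s v \<in> W) \<and>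
                    (\<forall>r. r \<noteq> 0 \<longrightarrow> h_op V i r v \<in> W)))"

definition simple_module :: bool where
  "simple_module \<longleftrightarrow> (\<exists>v :: 'v. v \<noteq> 0) \<and> (\<forall>W. submodule W \<longrightarrow> W = {0} \<or> W = UNIV)"

definition finite_dim :: bool where
  "finite_dim \<longleftrightarrow> (\<exists>B. finite B \<and> span B = UNIV)"

end


section \<open>Dominant monomials and the simple modules L(m)\<close>

text \<open>
  Dominant monomials form the free commutative monoid on the variables \<open>Y_{i,r} = Y_{i,aq^r}\<close>;
  they are written additively as multisets, so that products of monomials are sums of multisets.
\<close>

type_synonym monomial = "(nat \<times> int) multiset"

abbreviation Y :: "nat \<Rightarrow> int \<Rightarrow> monomial" where
  "Y i r \<equiv> {#(i, r)#}"

definition dominant_monomial :: "nat \<Rightarrow> monomial \<Rightarrow> bool" where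
  "dominant_monomial n m \<longleftrightarrow> set_mset m \<subseteq> {1..n} \<times> UNIV"

definition drinfeld_poly :: "complex \<Rightarrow> complex \<Rightarrow> monomial \<Rightarrow> nat \<Rightarrow> complex poly" where
  "drinfeld_poly q a m i =
     (\<Prod>(j, r)\<in>#filter_mset (\<lambda>(j, r). j = i) m. [:1, - (a * q powi r):])"

text \<open>
  The \<open>\<ell>\<close>-weight of \<open>m\<close> is the tuple of rational functions
  \<open>q^{deg P_i} P_i(q^{-1} u) / P_i(q u)\<close>, where \<open>P_i\<close> is the \<open>i\<close>-th Drinfeld polynomial of \<open>m\<close>.
  It is expanded in \<open>u\<close> at \<open>0\<close> for \<open>\<epsilon> = 1\<close>, and in \<open>u^{-1}\<close> at infinity for \<open>\<epsilon> = -1\<close>; as numerator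
  and denominator have the same degree, the latter amounts to reflecting both of them.
\<close>

definition lweight_series ::
  "complex \<Rightarrow> complex \<Rightarrow> monomial \<Rightarrow> int \<Rightarrow> nat \<Rightarrow> complex fps" where
  "lweight_series q a m \<epsilon> i =
     (let P = drinfeld_poly q a m i;
          R = (if \<epsilon> = 1 then (\<lambda>p. p) else reflect_poly)
      in fps_const (q ^ degree P)
           * (fps_of_poly (R (pcompose P [:0, inverse q:])) / fps_of_poly (R (pcompose P [:0, q:]))))"

definition highest_lweight_vector ::
  "nat \<Rightarrow> complex \<Rightarrow> complex \<Rightarrow> monomial \<Rightarrow> ('v::ab_group_add) uq_operators \<Rightarrow> 'v \<Rightarrow> bool" where
  "highest_lweight_vector n q a m V v \<longleftrightarrow>
     v \<noteq> 0 \<and> (\<forall>s. c_op V s v = v) \<and>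
     (\<forall>i\<in>{1..n}. (\<forall>r. x_op V 1 i r v = 0) \<and>
        (\<forall>\<epsilon>\<in>{1, -1}. \<forall>r::nat.
           phi_op q V \<epsilon> i (\<epsilon> * int r) v = vscale V (fps_nth (lweight_series q a m \<epsilon> i) r) v))"

text \<open>
  \<open>L(m)\<close> is determined up to isomorphism only, so it is rendered as the predicate
  ``the module \<open>V\<close> is (a model of) \<open>L(m)\<close>''.
\<close>

definition is_L ::
  "nat \<Rightarrow> complex \<Rightarrow> complex \<Rightarrow> monomial \<Rightarrow> ('v::ab_group_add) uq_operators \<Rightarrow> bool" where
  "is_L n q a m V \<longleftrightarrow>
     uq_affine_module V n q \<and> uq_affine_module.finite_dim V \<and>
     uq_affine_module.simple_module V n \<and> (\<exists>v. highest_lweight_vector n q a m V v)"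


section \<open>Hernandez-Leclerc modules\<close>

definition height_function :: "nat \<Rightarrow> (nat \<Rightarrow> int) \<Rightarrow> bool" where
  "height_function n \<xi> \<longleftrightarrow> (\<forall>i. 1 \<le> i \<and> i + 1 \<le> n \<longrightarrow> \<bar>\<xi> i - \<xi> (i + 1)\<bar> = 1)"

text \<open>
  The factors of \<open>\<omega>(i,j)\<close> are indexed by \<open>i\<close>, the turning points of \<open>\<xi>\<close> strictly between
  \<open>i\<close> and \<open>j\<close>, and \<open>j\<close>; each of the two conditionals covers exactly the two possible values of
  \<open>\<xi> (i + 1) - \<xi> i\<close>, respectively \<open>\<xi> p - \<xi> (p - 1)\<close>, for a height function.
\<close>

definition omega :: "(nat \<Rightarrow> int) \<Rightarrow> nat \<Rightarrow> nat \<Rightarrow> monomial" where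
  "omega \<xi> i j =
     Y i (if \<xi> (i + 1) = \<xi> i - 1 then \<xi> i + 1 else \<xi> i - 1)
     + (\<Sum>p\<in>{p. i < p \<and> p < j \<and> \<xi> (p - 1) = \<xi> (p + 1)} \<union> {j}.
          Y p (if \<xi> p = \<xi> (p - 1) + 1 then \<xi> p + 1 else \<xi> p - 1))"

definition Pr :: "nat \<Rightarrow> (nat \<Rightarrow> int) \<Rightarrow> monomial set" where
  "Pr n \<xi> = {Y i (\<xi> i + 1) | i. i \<in> {1..n}} \<union> {Y i (\<xi> i - 1) | i. i \<in> {1..n}}
     \<union> {omega \<xi> i j | i j. 1 \<le> i \<and> i < j \<and> j \<le> n}"

text \<open>
  The Hernandez-Leclerc modules attached to \<open>\<xi>\<close> that correspond to cluster variables are the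
  \<open>L(m)\<close> with \<open>m \<in> Pr n \<xi>\<close>; the frozen variables correspond to the remaining ones,
  \<open>L(Y_{i,\<xi>(i)-1} Y_{i,\<xi>(i)+1})\<close>.
\<close>

definition HL_cluster_module ::
  "nat \<Rightarrow> complex \<Rightarrow> complex \<Rightarrow> (nat \<Rightarrow> int) \<Rightarrow> ('v::ab_group_add) uq_operators \<Rightarrow> bool" where
  "HL_cluster_module n q a \<xi> V \<longleftrightarrow> (\<exists>m\<in>Pr n \<xi>. is_L n q a m V)"

end

theory Submission
  imports Defs
begin

text \<open>
  The statement splits into two independent facts.

  First, \<open>m\<close> is determined by \<open>L(m)\<close>: one simple module cannot carry highest \<open>\<ell>\<close>-weight vectors
  \<open>v\<close> and \<open>v'\<close> for two different dominant monomials (\<open>is_L_monomial_unique\<close>). Words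
  \<open>x\<^sup>-_{i_1,r_1} \<dots> x\<^sup>-_{i_k,r_k} v\<close> span a submodule, because the defining relations move \<open>h\<close>, \<open>K\<close> and
  \<open>x\<^sup>+\<close> to the right until they reach \<open>v\<close>; so they span the module. The product of the
  \<open>K_i\<close> to the powers \<open>i (n + 1 - i)\<close> acts on words of length \<open>k\<close> by \<open>d q^{-2k}\<close>, hence, as \<open>q\<close> is not a
  root of unity, \<open>v\<close> is not in the span \<open>U\<close> of the words of positive length.
  Write \<open>v' = c v + u\<close> with \<open>u \<in> U\<close>. If \<open>c \<noteq> 0\<close>, comparing the action of \<open>\<phi>^\<plusminus>_{i,r}\<close> modulo \<open>U\<close> shows that the \<open>\<ell>\<close>-weights agree; if \<open>c = 0\<close>, the words in \<open>v'\<close> all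
  lie in \<open>U\<close>, which contradicts that they span (\<open>lweight_unique\<close>). Finally the \<open>\<ell>\<close>-weight
  determines the monomial: comparing the zeros of numerators and denominators yields a finitely
  supported function on the integers of period 2, which vanishes (\<open>lweight_series_inj\<close>).

  Secondly, the monomials in \<open>Pr n \<xi>\<close>, for varying \<open>\<xi>\<close>, are exactly those of alternating
  sequences with the prescribed steps (\<open>Pr_iff_zigzag\<close>). If \<open>\<xi>\<close> has slope \<open>\<epsilon>\<close> just before the index \<open>i_l\<close>
  of a factor of \<open>\<omega>(i,j)\<close> other than the first, then \<open>a_l = \<xi>(i_l) + \<epsilon>\<close>, while the slope after
  \<open>i_l\<close> is \<open>-\<epsilon>\<close> unless \<open>i_l\<close> is the last index. So \<open>a_l\<close> overshoots the turning point by 1. The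
  second index of the first factor is \<open>\<xi>(i) - \<epsilon>\<close>, where \<open>\<epsilon>\<close> is the slope after \<open>i\<close>. Therefore
  consecutive \<open>a_l\<close> differ by the length of the monotone stretch plus 2, with alternating signs.
  Conversely, an alternating sequence prescribes the slopes of a piecewise linear \<open>\<xi>\<close>.
\<close>

section \<open>Compositions and the sum of the positive coroots\<close>

lemma finite_compositions: "finite (compositions r)"
proof (rule finite_subset)
  show "compositions r \<subseteq> {ss. set ss \<subseteq> {..r} \<and> length ss \<le> r}"
  proof
    fix ss assume ss: "ss \<in> compositions r"
    have "length ss \<le> sum_list ss" if "\<forall>s\<in>set ss. 0 < s" for ss :: "nat list"
      using that by (induction ss) auto
    with ss show "ss \<in> {ss. set ss \<subseteq> {..r} \<and> length ss \<le> r}"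
      by (auto simp: compositions_def intro: member_le_sum_list)
  qed
  show "finite {ss. set ss \<subseteq> {..r} \<and> length ss \<le> r}"
    by (rule finite_lists_length_le) simp
qed

lemma compositions_0: "compositions 0 = {[]}"
proof -
  have "ss = []" if "sum_list ss = 0" "\<forall>s\<in>set ss. 0 < s" for ss :: "nat list"
    using that by (cases ss) auto
  then show ?thesis by (auto simp: compositions_def)
qed

lemma composition_part_less:
  assumes "ss \<in> compositions r" "ss \<noteq> [r]" "s \<in> set ss"
  shows "s < r"
proof (rule ccontr)
  assume "\<not> s < r"
  obtain ys zs where ss: "ss = ys @ s # zs" using assms(3) by (meson split_list)
  have "sum_list ys = 0" "sum_list zs = 0" "s = r"
    using assms(1) \<open>\<not> s < r\<close> by (auto simp: compositions_def ss)
  moreover have "\<forall>s\<in>set ys. 0 < s" "\<forall>s\<in>set zs. 0 < s"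
    using assms(1) by (auto simp: compositions_def ss)
  ultimately have "ys \<in> compositions 0" "zs \<in> compositions 0"
    unfolding compositions_def by blast+
  then have "ys = []" "zs = []" by (simp_all add: compositions_0)
  with assms(2) ss \<open>s = r\<close> show False by simp
qed

text \<open>
  The sum of the positive coroots has the coordinates \<open>i (n + 1 - i)\<close> in the simple coroots, and it
  pairs to 2 with every simple root. So it measures the length of words of lowering operators.
\<close>

lemma cartan_sum:
  assumes "j \<in> {1..n}"
  shows "(\<Sum>i\<in>{1..n}. int (i * (n + 1 - i)) * cartan i j) = 2"
proof -
  define f where "f i = int i * (int n + 1 - int i)" for i
  have "(\<Sum>i\<in>{1..n}. int (i * (n + 1 - i)) * cartan i j) = (\<Sum>i\<in>{1..n}. f i * cartan i j)"
    by (rule sum.cong) (auto simp: f_def of_nat_diff)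
  \<comment> \<open>\<open>f\<close> vanishes at 0 and at \<open>n + 1\<close>, so the neighbours of \<open>j\<close> may be treated uniformly.\<close>
  also have "\<dots> = (\<Sum>i\<in>{0..n + 1}. f i * cartan i j)"
  proof (rule sum.mono_neutral_left)
    show "\<forall>i\<in>{0..n + 1} - {1..n}. f i * cartan i j = 0"
    proof
      fix i assume "i \<in> {0..n + 1} - {1..n}"
      then have "i = 0 \<or> i = n + 1" by auto
      then show "f i * cartan i j = 0" by (auto simp: f_def)
    qed
  qed auto
  also have "\<dots> = (\<Sum>i\<in>{j - 1, j, j + 1}. f i * cartan i j)"
    using assms by (intro sum.mono_neutral_right) (auto simp: cartan_def)
  also have "\<dots> = 2 * f j - f (j - 1) - f (j + 1)"
    using assms by (cases j) (auto simp: cartan_def)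
  also have "\<dots> = 2"
    using assms by (simp add: f_def of_nat_diff algebra_simps)
  finally show ?thesis .
qed

section \<open>Operators on a module\<close>

context uq_affine_module
begin

lemma linear_map_simps:
  assumes "Vector_Spaces.linear (vscale V) (vscale V) f"
  shows "f (x + y) = f x + f y" "f (vscale V c x) = vscale V c (f x)" "f 0 = 0"
    "f (x - y) = f x - f y"
proof -
  interpret f: Vector_Spaces.linear "vscale V" "vscale V" f by fact
  show "f (x + y) = f x + f y" "f (vscale V c x) = vscale V c (f x)" "f 0 = 0"
    "f (x - y) = f x - f y"
    by (simp_all add: f.add f.scale f.diff f.zero)
qed

lemma linear_mapI:
  assumes "\<And>x y. f (x + y) = f x + f y" "\<And>c x. f (vscale V c x) = vscale V c (f x)"
  shows "Vector_Spaces.linear (vscale V) (vscale V) f"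
  using assms vector_space_axioms by (simp add: Vector_Spaces.linear_iff)

lemma linear_maps_span:
  assumes f: "Vector_Spaces.linear (vscale V) (vscale V) f"
    and u: "u \<in> span S" and "subspace T" "\<And>w. w \<in> S \<Longrightarrow> f w \<in> T"
  shows "f u \<in> T"
proof -
  have "subspace {x. f x \<in> T}"
    using \<open>subspace T\<close> by (auto simp: subspace_def linear_map_simps[OF f])
  then have "span S \<subseteq> {x. f x \<in> T}"
    using assms(4) by (intro span_minimal) auto
  with u show ?thesis by blast
qed

lemma linear_foldr:
  assumes "\<And>x. x \<in> set L \<Longrightarrow> Vector_Spaces.linear (vscale V) (vscale V) (g x)"
  shows "Vector_Spaces.linear (vscale V) (vscale V) (foldr g L)"
  using assms
proof (induction L)
  case Nil
  then show ?case by (intro linear_mapI) auto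
next
  case (Cons a L)
  then have a: "Vector_Spaces.linear (vscale V) (vscale V) (g a)"
    and L: "Vector_Spaces.linear (vscale V) (vscale V) (foldr g L)" by auto
  show ?case by (rule linear_mapI) (simp_all add: linear_map_simps[OF a] linear_map_simps[OF L])
qed

lemma linear_h_foldr:
  assumes "\<epsilon> \<in> {1, -1}" "i \<in> {1..n}" "ss \<in> compositions r"
  shows "Vector_Spaces.linear (vscale V) (vscale V) (foldr (\<lambda>s. h_op V i (\<epsilon> * int s)) ss)"
  using assms by (intro linear_foldr h_linear) (auto simp: compositions_def)

lemma phi_linear:
  assumes "\<epsilon> \<in> {1, -1}" "i \<in> {1..n}"
  shows "Vector_Spaces.linear (vscale V) (vscale V) (phi_op q V \<epsilon> i r)"
proof (rule linear_mapI)
  note k = linear_map_simps[OF k_linear[OF assms(2)]]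
  note h = linear_map_simps[OF linear_h_foldr[OF assms]]
  show "phi_op q V \<epsilon> i r (x + y) = phi_op q V \<epsilon> i r x + phi_op q V \<epsilon> i r y" for x y
    by (simp add: phi_op_def k[symmetric] sum.distrib[symmetric] scale_right_distrib[symmetric] h
        cong: sum.cong)
  show "phi_op q V \<epsilon> i r (vscale V c x) = vscale V c (phi_op q V \<epsilon> i r x)" for c x
    by (simp add: phi_op_def k[symmetric] scale_sum_right h mult.commute cong: sum.cong)
qed

lemma phi_stable:
  assumes "\<epsilon> \<in> {1, -1}" "i \<in> {1..n}" "subspace T" "w \<in> T"
    and "\<And>s w. w \<in> T \<Longrightarrow> k_op V i s w \<in> T"
    and h: "\<And>r w. r \<noteq> 0 \<Longrightarrow> w \<in> T \<Longrightarrow> h_op V i r w \<in> T"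
  shows "phi_op q V \<epsilon> i r w \<in> T"
proof -
  have "foldr (\<lambda>s. h_op V i (\<epsilon> * int s)) ss w \<in> T" if "\<forall>s\<in>set ss. 0 < s" for ss
    using that assms(1,4) by (induction ss) (auto intro!: h)
  then have "foldr (\<lambda>s. h_op V i (\<epsilon> * int s)) ss w \<in> T" if "ss \<in> compositions l" for ss l
    using that by (simp add: compositions_def)
  then have "(\<Sum>ss\<in>compositions l. vscale V (c ss) (foldr (\<lambda>s. h_op V i (\<epsilon> * int s)) ss w)) \<in> T" for c l
    using assms(3) by (intro subspace_sum subspace_scale) auto
  with assms(3,5) show ?thesis
    unfolding phi_op_def by (simp add: subspace_0)
qed

lemma k_x_pow:
  assumes "i \<in> {1..n}" "j \<in> {1..n}"
  shows "k_op V i (int s) (x_op V (-1) j r w)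
    = vscale V ((q powi (- cartan i j)) ^ s) (x_op V (-1) j r (k_op V i (int s) w))"
proof (induction s)
  case 0
  then show ?case using assms by (simp add: k_zero)
next
  case (Suc s)
  have step: "k_op V i 1 (x_op V (-1) j r w)
      = vscale V (q powi (- cartan i j)) (x_op V (-1) j r (k_op V i 1 w))" for w
    using k_x[of "-1" i j r "k_op V i 1 w"] assms k_add[of i "-1" 1 w, symmetric] by (simp add: k_zero)
  have "k_op V i (int (Suc s)) w = k_op V i 1 (k_op V i (int s) w)" for w
    using k_add[OF assms(1), of 1 "int s" w] by simp
  then show ?case
    by (simp add: Suc step linear_map_simps[OF k_linear[OF assms(1)]] mult.commute)
qed

end

section \<open>The module generated by a highest weight vector\<close>

text \<open>
  \<open>lowering_word V n v k w\<close>: the vector \<open>w\<close> is obtained from \<open>v\<close> by applying \<open>k\<close> of the operators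
  \<open>x\<^sup>-_{i,r}\<close>.
\<close>

inductive lowering_word :: "('v::ab_group_add) uq_operators \<Rightarrow> nat \<Rightarrow> 'v \<Rightarrow> nat \<Rightarrow> 'v \<Rightarrow> bool"
  for V n v where
  lowering_word_base: "lowering_word V n v 0 v"
| lowering_word_step: "lowering_word V n v k w \<Longrightarrow> i \<in> {1..n}
    \<Longrightarrow> lowering_word V n v (Suc k) (x_op V (-1) i r w)"

text \<open>
  A vector \<open>v\<close> on which \<open>c^{1/2}\<close> acts trivially, that is killed by all \<open>x\<^sup>+_{i,r}\<close> and on which
  \<open>\<phi>^\<plusminus>_{i,\<plusminus>l}\<close> acts by a scalar \<open>\<Psi> (\<plusminus>1) i l\<close>. The scalars are
  arbitrary: they need not come from Drinfeld polynomials.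
\<close>

locale highest_weight_vector = uq_affine_module V n q
  for V :: "('v::ab_group_add) uq_operators" and n :: nat and q :: complex +
  fixes v :: 'v and \<Psi> :: "int \<Rightarrow> nat \<Rightarrow> nat \<Rightarrow> complex"
  assumes q_nonzero: "q \<noteq> 0" and q_no_root: "0 < k \<Longrightarrow> q ^ k \<noteq> 1"
    and v_nonzero: "v \<noteq> 0"
    and c_v: "c_op V s v = v"
    and x_v: "i \<in> {1..n} \<Longrightarrow> x_op V 1 i r v = 0"
    and phi_v: "\<lbrakk>\<epsilon> \<in> {1, -1}; i \<in> {1..n}\<rbrakk> \<Longrightarrow> phi_op q V \<epsilon> i (\<epsilon> * int l) v = vscale V (\<Psi> \<epsilon> i l) v"
begin

abbreviation words :: "nat \<Rightarrow> 'v set" where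
  "words k \<equiv> {w. lowering_word V n v k w}"

lemma q_diff: "q - inverse q \<noteq> 0"
proof
  assume "q - inverse q = 0"
  then have "q ^ 2 = 1" using q_nonzero by (simp add: power2_eq_square field_simps)
  then show False using q_no_root[of 2] by simp
qed

lemma k_v:
  assumes "i \<in> {1..n}" "\<epsilon> \<in> {1, -1}"
  shows "k_op V i \<epsilon> v = vscale V (\<Psi> \<epsilon> i 0) v"
  using phi_v[of \<epsilon> i 0] assms by (simp add: phi_op_def compositions_0)

lemma k_stable_v:
  assumes i: "i \<in> {1..n}" and "w \<in> span {v}"
  shows "k_op V i s w \<in> span {v}"
proof -
  have nat: "k_op V i (\<epsilon> * int s) v \<in> span {v}" if "\<epsilon> \<in> {1, -1}" for \<epsilon> s
  proof (induction s)
    case 0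
    then show ?case using i by (simp add: k_zero span_base)
  next
    case (Suc s)
    have "k_op V i (\<epsilon> * int (Suc s)) v = k_op V i (\<epsilon> * int s) (k_op V i \<epsilon> v)"
      using k_add[OF i, of "\<epsilon> * int s" \<epsilon> v] by (simp add: algebra_simps)
    also have "\<dots> \<in> span {v}"
      using Suc by (simp only: k_v[OF i that] linear_map_simps[OF k_linear[OF i]] span_scale)
    finally show ?case .
  qed
  have "k_op V i s v \<in> span {v}"
    using nat[of 1 "nat s"] nat[of "-1" "nat (- s)"] by (cases "0 \<le> s") auto
  then show ?thesis
    using linear_maps_span[OF k_linear[OF i], where S = "{v}" and T = "span {v}"] assms(2) by auto
qed

text \<open>
  The coefficient \<open>\<phi>^\<plusminus>_{i,\<plusminus>s}\<close> is \<open>K_i^{\<plusminus>1}\<close> applied to a nonzero multiple of \<open>h_{i,\<plusminus>s}\<close> plus products of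
  \<open>h_{i,\<plusminus>l}\<close> with \<open>l < s\<close>. Therefore a common eigenvector of the \<open>\<phi>\<close> is one of the \<open>h\<close>, by induction
  on \<open>s\<close>.
\<close>

lemma h_v_aux:
  assumes i: "i \<in> {1..n}" and e: "\<epsilon> \<in> {1, -1}" and "0 < s"
  shows "h_op V i (\<epsilon> * int s) v \<in> span {v}"
  using \<open>0 < s\<close>
proof (induction s rule: less_induct)
  case (less s)
  define t where "t ss = vscale V ((of_int \<epsilon> * (q - inverse q)) ^ length ss / fact (length ss))
             (foldr (\<lambda>s. h_op V i (\<epsilon> * int s)) ss v)" for ss
  have "\<epsilon> * \<epsilon> = 1" using e by auto
  then have ee: "\<epsilon> * (\<epsilon> * int s) = int s" by (metis mult.assoc mult_1)
  have "phi_op q V \<epsilon> i (\<epsilon> * int s) v = k_op V i \<epsilon> (\<Sum>ss\<in>compositions s. t ss)"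
    unfolding phi_op_def t_def ee by simp
  \<comment> \<open>Undo \<open>K_i\<close>, then isolate the composition of \<open>s\<close> into a single part.\<close>
  then have "k_op V i (-\<epsilon>) (k_op V i \<epsilon> (\<Sum>ss\<in>compositions s. t ss)) \<in> span {v}"
    using k_stable_v[OF i span_scale[OF span_base], of v "-\<epsilon>" "\<Psi> \<epsilon> i s"] phi_v[OF e i, of s] by simp
  then have sum: "(\<Sum>ss\<in>compositions s. t ss) \<in> span {v}"
    using k_add[OF i, of "-\<epsilon>" \<epsilon>] by (simp add: k_zero[OF i])
  have hh: "h_op V i (\<epsilon> * int l) w \<in> span {v}" if "w \<in> span {v}" "0 < l" "l < s" for l w
    using linear_maps_span[OF h_linear[OF i, of "\<epsilon> * int l"], where S = "{v}" and T = "span {v}" and u = w] less.IH[of l] that e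
    by auto
  have "t ss \<in> span {v}" if "ss \<in> compositions s - {[s]}" for ss
  proof -
    have "\<forall>l\<in>set ss. 0 < l \<and> l < s"
      using that composition_part_less[of ss s] by (auto simp: compositions_def)
    then have "foldr (\<lambda>s. h_op V i (\<epsilon> * int s)) ss v \<in> span {v}"
      by (induction ss) (auto intro: hh span_base)
    then show ?thesis by (simp add: t_def span_scale)
  qed
  then have "(\<Sum>ss\<in>compositions s - {[s]}. t ss) \<in> span {v}" by (rule span_sum)
  moreover have "[s] \<in> compositions s" using less.prems by (simp add: compositions_def)
  then have "t [s] = (\<Sum>ss\<in>compositions s. t ss) - (\<Sum>ss\<in>compositions s - {[s]}. t ss)"
    by (simp add: sum.remove[OF finite_compositions])
  ultimately have ts: "t [s] \<in> span {v}" using sum by (simp add: span_diff)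
  define c where "c = of_int \<epsilon> * (q - inverse q)"
  have "c \<noteq> 0" using q_diff e by (auto simp: c_def)
  moreover have "t [s] = vscale V c (h_op V i (\<epsilon> * int s) v)" by (simp add: t_def c_def)
  ultimately have "h_op V i (\<epsilon> * int s) v = vscale V (inverse c) (t [s])" by simp
  then show ?case using span_scale[OF ts] by simp
qed

lemma h_v:
  assumes i: "i \<in> {1..n}" and "r \<noteq> 0"
  shows "h_op V i r v \<in> span {v}"
proof (cases "0 < r")
  case True
  then show ?thesis using h_v_aux[OF i, of 1 "nat r"] by simp
next
  case False
  then show ?thesis using h_v_aux[OF i, of "-1" "nat (- r)"] assms by simp
qed

lemma words_0: "words 0 = {v}"
  by (auto intro: lowering_word_base elim: lowering_word.cases)

lemma c_word: "lowering_word V n v k w \<Longrightarrow> c_op V s w = w"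
  by (induction rule: lowering_word.induct) (auto simp: c_v c_x)

lemma c_span:
  assumes "w \<in> span (words k)" shows "c_op V s w = w"
proof -
  have "subspace {w. c_op V s w = w}"
    by (auto simp: subspace_def linear_map_simps[OF c_linear])
  then have "span (words k) \<subseteq> {w. c_op V s w = w}"
    by (intro span_minimal) (auto simp: c_word)
  with assms show ?thesis by blast
qed

lemma lowering_span:
  assumes "i \<in> {1..n}" "w \<in> span (words k)"
  shows "x_op V (-1) i r w \<in> span (words (Suc k))"
proof (rule linear_maps_span[OF x_linear assms(2)])
  show "x_op V (-1) i r w \<in> span (words (Suc k))" if "w \<in> words k" for w
    using that assms(1) by (intro span_base) (simp add: lowering_word_step)
qed (use assms(1) in auto)

lemma h_span:
  assumes i: "i \<in> {1..n}" and r: "r \<noteq> 0" and "w \<in> span (words k)"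
  shows "h_op V i r w \<in> span (words k)"
proof -
  have "h_op V i r w \<in> span (words k)" if "lowering_word V n v k w" for w
    using that i r
  proof (induction arbitrary: r rule: lowering_word.induct)
    case lowering_word_base
    then show ?case using h_v words_0 by simp
  next
    case (lowering_word_step k w j s)
    have "h_op V i r (x_op V (-1) j s w) = x_op V (-1) j s (h_op V i r w)
       + vscale V (of_int (-1) * qint q (r * cartan i j) / of_int r)
            (c_op V \<bar>r\<bar> (x_op V (-1) j (r + s) w))"
      using h_x[of "-1" i j r s w] lowering_word_step by (simp add: algebra_simps)
    also have "c_op V \<bar>r\<bar> (x_op V (-1) j (r + s) w) = x_op V (-1) j (r + s) w"
      using lowering_word_step c_word by (intro c_span[of _ "Suc k"] lowering_span span_base) auto
    finally have eq: "h_op V i r (x_op V (-1) j s w) = x_op V (-1) j s (h_op V i r w)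
       + vscale V (of_int (-1) * qint q (r * cartan i j) / of_int r) (x_op V (-1) j (r + s) w)" .
    have "w \<in> span (words k)" "h_op V i r w \<in> span (words k)"
      using lowering_word_step by (auto intro: span_base)
    then show ?case
      unfolding eq using lowering_word_step.hyps(2) by (intro span_add span_scale lowering_span)
  qed
  then show ?thesis
    by (intro linear_maps_span[OF h_linear[OF i r] assms(3)]) auto
qed

lemma k_x_int:
  assumes i: "i \<in> {1..n}" and j: "j \<in> {1..n}"
  shows "\<exists>c. \<forall>w. k_op V i s (x_op V (-1) j r w) = vscale V c (x_op V (-1) j r (k_op V i s w))"
proof (cases "0 \<le> s")
  case True
  then show ?thesis using k_x_pow[OF i j, of "nat s" r] by auto
next
  case False
  define c where "c = (q powi (- cartan i j)) ^ nat (- s)"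
  have "c \<noteq> 0" using q_nonzero by (simp add: c_def)
  have inv: "k_op V i s (k_op V i (- s) w) = w" "k_op V i (- s) (k_op V i s w) = w" for w
    using k_add[OF i, of "- s" s w] k_add[OF i, of s "- s" w] by (simp_all add: k_zero[OF i])
  have "k_op V i s (x_op V (-1) j r w) = vscale V (inverse c) (x_op V (-1) j r (k_op V i s w))" for w
  proof -
    have "k_op V i (- s) (x_op V (-1) j r (k_op V i s w)) = vscale V c (x_op V (-1) j r w)"
      using k_x_pow[OF i j, of "nat (- s)" r "k_op V i s w"] False by (simp add: c_def inv)
    then have "x_op V (-1) j r (k_op V i s w) = vscale V c (k_op V i s (x_op V (-1) j r w))"
      by (metis inv(1) linear_map_simps(2)[OF k_linear[OF i]])
    then show ?thesis using \<open>c \<noteq> 0\<close> by simp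
  qed
  then show ?thesis by blast
qed

lemma k_span:
  assumes i: "i \<in> {1..n}" and "w \<in> span (words k)"
  shows "k_op V i s w \<in> span (words k)"
proof -
  have "k_op V i s w \<in> span (words k)" if "lowering_word V n v k w" for w
    using that
  proof (induction rule: lowering_word.induct)
    case lowering_word_base
    then show ?case using k_stable_v[OF i, of v] words_0 by (simp add: span_base)
  next
    case (lowering_word_step k w j r)
    obtain c where "k_op V i s (x_op V (-1) j r w) = vscale V c (x_op V (-1) j r (k_op V i s w))"
      using k_x_int[OF i lowering_word_step.hyps(2), of s r] by blast
    then show ?case
      using span_scale[OF lowering_span[OF lowering_word_step.hyps(2) lowering_word_step.IH]] by simp
  qed
  then show ?thesis
    by (intro linear_maps_span[OF k_linear[OF i] assms(2)]) auto
qed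

lemma phi_span:
  assumes "\<epsilon> \<in> {1, -1}" "i \<in> {1..n}" "w \<in> span (words k)"
  shows "phi_op q V \<epsilon> i r w \<in> span (words k)"
  using assms by (intro phi_stable[where T = "span (words k)"]) (auto intro: k_span h_span)

text \<open>
  Commuting \<open>x\<^sup>+\<close> past a lowering operator leaves a \<open>\<phi>\<close>, which preserves the length of words. For
  \<open>k = 0\<close> the truncated \<open>k - 1\<close> is harmless, as \<open>x\<^sup>+\<close> then gives 0.
\<close>

lemma raising_word:
  assumes "lowering_word V n v k w" "i \<in> {1..n}"
  shows "x_op V 1 i r w \<in> span (words (k - 1))"
  using assms
proof (induction arbitrary: r rule: lowering_word.induct)
  case lowering_word_base
  then show ?case by (simp add: x_v span_zero)
next
  case (lowering_word_step k w j s)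
  note w = span_base[of w "words k"]
  have L: "Vector_Spaces.linear (vscale V) (vscale V) (x_op V (-1) j s)"
    using lowering_word_step by (intro x_linear) auto
  have "x_op V (-1) j s (x_op V 1 i r w) \<in> span (words k)"
  proof (cases k)
    case 0
    then have "w = v" using lowering_word_step words_0 by auto
    then show ?thesis using lowering_word_step x_v by (simp add: linear_map_simps[OF L] span_zero)
  next
    case (Suc l)
    then show ?thesis using lowering_word_step lowering_span[of j _ l] by simp
  qed
  moreover have "x_op V 1 i r (x_op V (-1) j s w) - x_op V (-1) j s (x_op V 1 i r w) \<in> span (words k)"
  proof (cases "i = j")
    case True
    have phi: "phi_op q V \<epsilon> i l w \<in> span (words k)" if "\<epsilon> \<in> {1, -1}" for l \<epsilon>
      using that lowering_word_step w by (intro phi_span) auto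
    have "c_op V t (phi_op q V \<epsilon> i l w) \<in> span (words k)" if "\<epsilon> \<in> {1, -1}" for t l \<epsilon>
      using phi[OF that] c_span[OF phi[OF that]] by simp
    then show ?thesis
      using xp_xm[of i j r s w] lowering_word_step True by (simp add: span_scale span_diff)
  next
    case False
    then show ?thesis using xp_xm[of i j r s w] lowering_word_step by (simp add: span_zero)
  qed
  ultimately show ?case
    using span_add[of "x_op V (-1) j s (x_op V 1 i r w)" "words k"] by fastforce
qed

lemma words_span_UNIV:
  assumes "simple_module"
  shows "span (\<Union>k. words k) = UNIV"
proof -
  let ?W = "span (\<Union>k. words k)"
  have sub: "span (words k) \<subseteq> ?W" for k by (intro span_mono) auto
  have "submodule ?W"
    unfolding submodule_def
  proof (intro conjI ballI allI impI)
    show "subspace ?W" by simp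
  next
    fix w s assume w: "w \<in> ?W"
    show "c_op V s w \<in> ?W"
      by (rule linear_maps_span[OF c_linear w]) (auto simp: c_word intro!: span_base)
  next
    fix w s i assume w: "w \<in> ?W" and i: "i \<in> {1..n}"
    have "k_op V i s w' \<in> ?W" if "w' \<in> words k" for w' k
      using k_span[OF i span_base[OF that]] sub by blast
    then show "k_op V i s w \<in> ?W"
      by (intro linear_maps_span[OF k_linear[OF i] w]) auto
  next
    fix w r i assume w: "w \<in> ?W" and i: "i \<in> {1..n}" and r: "r \<noteq> (0::int)"
    have "h_op V i r w' \<in> ?W" if "w' \<in> words k" for w' k
      using h_span[OF i r span_base[OF that]] sub by blast
    then show "h_op V i r w \<in> ?W"
      by (intro linear_maps_span[OF h_linear[OF i r] w]) auto
  next
    fix w r i and \<epsilon> :: int assume w: "w \<in> ?W" and i: "i \<in> {1..n}" and e: "\<epsilon> \<in> {1, -1}"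
    have "x_op V \<epsilon> i r w' \<in> ?W" if "w' \<in> words k" for w' k
    proof (cases "\<epsilon> = 1")
      case True
      then show ?thesis using raising_word[OF _ i] that sub by blast
    next
      case False
      then show ?thesis using lowering_span[OF i span_base[OF that]] e sub by blast
    qed
    then show "x_op V \<epsilon> i r w \<in> ?W"
      by (intro linear_maps_span[OF x_linear[OF e i] w]) auto
  qed
  then have "?W = {0} \<or> ?W = UNIV" using assms by (simp add: simple_module_def)
  moreover have "v \<in> ?W" using words_0 by (intro span_base) blast
  ultimately show ?thesis using v_nonzero by auto
qed

text \<open>
  The product of the \<open>K_i\<close> to the powers \<open>i (n + 1 - i)\<close>; it grades the module by the length of words.
\<close>

definition degree_op :: "'v \<Rightarrow> 'v" where
  "degree_op = foldr (\<lambda>i. k_op V i (int (i * (n + 1 - i)))) [1..<n + 1]"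

lemma degree_op_linear: "Vector_Spaces.linear (vscale V) (vscale V) degree_op"
  unfolding degree_op_def by (intro linear_foldr k_linear) auto

lemma degree_op_x:
  assumes j: "j \<in> {1..n}"
  shows "degree_op (x_op V (-1) j r w) = vscale V (q powi (-2)) (x_op V (-1) j r (degree_op w))"
proof -
  let ?s = "\<lambda>i. i * (n + 1 - i)"
  let ?F = "foldr (\<lambda>i. k_op V i (int (?s i)))"
  have F: "?F L (x_op V (-1) j r w)
      = vscale V (q powi (- (\<Sum>i\<leftarrow>L. int (?s i) * cartan i j))) (x_op V (-1) j r (?F L w))"
    if "set L \<subseteq> {1..n}" for L
    using that
  proof (induction L)
    case (Cons i L)
    then have i: "i \<in> {1..n}" by simp
    have "(q powi (- cartan i j)) ^ ?s i = q powi (- (int (?s i) * cartan i j))"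
    proof -
      have "(q powi (- cartan i j)) ^ ?s i = q powi (- cartan i j * int (?s i))"
        by (simp only: power_int_mult power_int_of_nat)
      also have "- cartan i j * int (?s i) = - (int (?s i) * cartan i j)"
        by (simp only: mult_minus_left mult.commute)
      finally show ?thesis .
    qed
    moreover have "q powi (- (A + B)) = q powi (- B) * q powi (- A)" for A B
      using power_int_add[of q "- B" "- A"] q_nonzero by (simp add: algebra_simps)
    ultimately show ?case
      using Cons by (simp add: linear_map_simps[OF k_linear[OF i]] k_x_pow[OF i j] del: of_nat_mult)
  qed simp
  have "set [1..<n + 1] \<subseteq> {1..n}" by auto
  from F[OF this]
  have "degree_op (x_op V (-1) j r w)
     = vscale V (q powi (- (\<Sum>i\<leftarrow>[1..<n + 1]. int (?s i) * cartan i j))) (x_op V (-1) j r (degree_op w))"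
    by (simp only: degree_op_def)
  also have "(\<Sum>i\<leftarrow>[1..<n + 1]. int (?s i) * cartan i j) = (\<Sum>i\<in>{1..n}. int (?s i) * cartan i j)"
    by (simp only: interv_sum_list_conv_sum_set_nat set_upt Suc_eq_plus1[symmetric] atLeastLessThanSuc_atLeastAtMost)
  finally show ?thesis by (simp only: cartan_sum[OF j])
qed

lemma degree_op_v: "\<exists>d. d \<noteq> 0 \<and> degree_op v = vscale V d v"
proof -
  have "\<exists>d. d \<noteq> 0 \<and> foldr (\<lambda>i. k_op V i (int (i * (n + 1 - i)))) L v = vscale V d v"
    if "set L \<subseteq> {1..n}" for L
    using that
  proof (induction L)
    case Nil
    then show ?case by (intro exI[of _ 1]) simp
  next
    case (Cons i L)
    then have i: "i \<in> {1..n}" by simp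
    let ?s = "int (i * (n + 1 - i))"
    from Cons obtain d where d: "d \<noteq> 0" "foldr (\<lambda>i. k_op V i (int (i * (n + 1 - i)))) L v = vscale V d v"
      by auto
    obtain c where c: "k_op V i ?s v = vscale V c v"
      using k_stable_v[OF i span_base, of v ?s] by (auto simp: span_singleton)
    have "k_op V i (- ?s) (k_op V i ?s v) = v"
      using k_add[OF i, of "- ?s" ?s v] by (simp add: k_zero[OF i] del: of_nat_mult)
    then have "c \<noteq> 0" using c v_nonzero linear_map_simps(3)[OF k_linear[OF i]] by auto
    then show ?case
      using d c by (intro exI[of _ "d * c"]) (simp add: linear_map_simps[OF k_linear[OF i]] del: of_nat_mult)
  qed
  from this[of "[1..<n + 1]"] show ?thesis unfolding degree_op_def by fastforce
qed

lemma degree_op_word: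
  assumes "degree_op v = vscale V d v" "lowering_word V n v k w"
  shows "degree_op w = vscale V (d * q powi (- 2 * int k)) w"
  using assms(2)
proof (induction rule: lowering_word.induct)
  case lowering_word_base
  then show ?case using assms(1) by simp
next
  case (lowering_word_step k w j r)
  have L: "Vector_Spaces.linear (vscale V) (vscale V) (x_op V (-1) j r)"
    using lowering_word_step by (intro x_linear) auto
  have "q powi (- 2 * int (Suc k)) = q powi (-2) * q powi (- 2 * int k)"
    using q_nonzero by (simp flip: power_int_add)
  then show ?case
    using lowering_word_step by (simp add: degree_op_x linear_map_simps[OF L] ac_simps)
qed

text \<open>The span of the words of positive length.\<close>

definition proper_span :: "'v set" where
  "proper_span = span (\<Union>k. words (Suc k))"

lemma v_notin_proper_span: "v \<notin> proper_span"
proof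
  assume v: "v \<in> proper_span"
  obtain d where d: "d \<noteq> 0" "degree_op v = vscale V d v" using degree_op_v by blast
  define \<mu> where "\<mu> k = d * q powi (- 2 * int k)" for k :: nat
  define g where "g k w = degree_op w - vscale V (\<mu> k) w" for k w
  \<comment> \<open>\<open>A N\<close> kills every word of length between 1 and \<open>N\<close>, but it does not kill \<open>v\<close>.\<close>
  define A where "A N = foldr g [1..<Suc N]" for N
  have g: "Vector_Spaces.linear (vscale V) (vscale V) (g k)" for k
    by (rule linear_mapI) (simp_all add: g_def linear_map_simps[OF degree_op_linear]
        scale_right_distrib scale_right_diff_distrib mult.commute)
  have A: "Vector_Spaces.linear (vscale V) (vscale V) (A N)" for N
    unfolding A_def by (intro linear_foldr g)
  have A_word: "A N w = vscale V (\<Prod>l\<leftarrow>[1..<Suc N]. \<mu> k - \<mu> l) w"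
    if "lowering_word V n v k w" for N k w
  proof -
    have gw: "g l w = vscale V (\<mu> k - \<mu> l) w" for l
      using degree_op_word[OF d(2) that] by (simp add: g_def \<mu>_def scale_left_diff_distrib)
    have "foldr g L w = vscale V (\<Prod>l\<leftarrow>L. \<mu> k - \<mu> l) w" for L
      by (induction L) (simp_all add: linear_map_simps[OF g] gw mult.commute)
    then show ?thesis by (simp add: A_def)
  qed
  define E where "E = {w. \<exists>N. \<forall>M\<ge>N. A M w = 0}"
  have "subspace E"
    unfolding subspace_def
  proof (intro conjI ballI allI)
    fix x y assume "x \<in> E" "y \<in> E"
    then obtain N N' where "\<forall>M\<ge>N. A M x = 0" "\<forall>M\<ge>N'. A M y = 0" by (auto simp: E_def)
    then have "\<forall>M\<ge>max N N'. A M (x + y) = 0" by (simp add: linear_map_simps[OF A])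
    then show "x + y \<in> E" unfolding E_def by blast
  qed (auto simp: E_def linear_map_simps[OF A])
  moreover have "words (Suc k) \<subseteq> E" for k
  proof
    fix w assume "w \<in> words (Suc k)"
    then have "A M w = 0" if "M \<ge> Suc k" for M
      using that A_word[of "Suc k" w M] by (auto simp: prod_list_zero_iff image_iff simp del: upt_Suc)
    then show "w \<in> E" by (auto simp: E_def)
  qed
  ultimately have "proper_span \<subseteq> E"
    unfolding proper_span_def by (intro span_minimal) auto
  with v obtain N where "A N v = 0" by (auto simp: E_def)
  then have "(\<Prod>l\<leftarrow>[1..<Suc N]. \<mu> 0 - \<mu> l) = 0"
    using A_word[OF lowering_word_base, of N] v_nonzero by simp
  then have "0 \<in> (\<lambda>l. \<mu> 0 - \<mu> l) ` set [1..<Suc N]"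
    unfolding prod_list_zero_iff set_map .
  then obtain l where "l \<in> set [1..<Suc N]" "0 = \<mu> 0 - \<mu> l" by (rule imageE)
  then have "0 < l" "\<mu> 0 = \<mu> l" by (simp_all del: upt_Suc)
  then have "q powi (- int (2 * l)) = 1" using d by (simp add: \<mu>_def)
  then have "q ^ (2 * l) = 1"
    unfolding power_int_minus power_int_of_nat by simp
  then show False using q_no_root[of "2 * l"] \<open>0 < l\<close> by simp
qed

end

lemma (in uq_affine_module) lweight_unique:
  assumes "highest_weight_vector V n q v \<Psi>" "highest_weight_vector V n q v' \<Psi>'" "simple_module"
    and e: "\<epsilon> \<in> {1, -1}" and i: "i \<in> {1..n}"
  shows "\<Psi> \<epsilon> i l = \<Psi>' \<epsilon> i l"
proof (rule ccontr)
  assume neq: "\<Psi> \<epsilon> i l \<noteq> \<Psi>' \<epsilon> i l"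
  interpret v: highest_weight_vector V n q v \<Psi> by fact
  interpret v': highest_weight_vector V n q v' \<Psi>' by fact
  have sub: "span (v.words (Suc k)) \<subseteq> v.proper_span" for k
    unfolding v.proper_span_def by (intro span_mono) auto
  have phi: "phi_op q V \<epsilon> i r u \<in> v.proper_span" if u: "u \<in> v.proper_span" for r u
  proof (rule linear_maps_span[OF phi_linear[OF e i] u[unfolded v.proper_span_def]])
    show "phi_op q V \<epsilon> i r w \<in> v.proper_span" if "w \<in> (\<Union>k. v.words (Suc k))" for w
      using that v.phi_span[OF e i span_base] sub by blast
  qed (simp add: v.proper_span_def)
  have lower: "x_op V (-1) j r u \<in> v.proper_span" if u: "u \<in> v.proper_span" and j: "j \<in> {1..n}" for j r u
  proof (rule linear_maps_span[OF x_linear[OF _ j] u[unfolded v.proper_span_def]])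
    show "x_op V (-1) j r w \<in> v.proper_span" if "w \<in> (\<Union>k. v.words (Suc k))" for w
      using that v.lowering_span[OF j span_base] sub by blast
  qed (simp_all add: v.proper_span_def)
  have "v' \<in> span (insert v (\<Union>k. v.words (Suc k)))"
  proof -
    have "(\<Union>k. v.words k) \<subseteq> insert v (\<Union>k. v.words (Suc k))"
      using v.words_0 by (metis (no_types, lifting) UN_least UN_upper insert_is_Un not0_implies_Suc
          le_supI1 le_supI2 order_refl UNIV_I)
    then show ?thesis
      using v.words_span_UNIV[OF assms(3)] span_mono by blast
  qed
  then obtain c where u: "v' - vscale V c v \<in> v.proper_span"
    by (auto simp: span_insert v.proper_span_def)
  define u where "u = v' - vscale V c v"
  have v': "v' = vscale V c v + u" by (simp add: u_def)
  have u: "u \<in> v.proper_span" using u by (simp add: u_def)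
  have subsp: "subspace v.proper_span" by (simp add: v.proper_span_def)
  have "vscale V (\<Psi>' \<epsilon> i l) v' = vscale V (c * \<Psi> \<epsilon> i l) v + phi_op q V \<epsilon> i (\<epsilon> * int l) u"
    using v'.phi_v[OF e i, of l]
    by (subst (asm) v') (simp add: linear_map_simps[OF phi_linear[OF e i]] v.phi_v[OF e i])
  then have "vscale V (c * (\<Psi>' \<epsilon> i l - \<Psi> \<epsilon> i l)) v
      = phi_op q V \<epsilon> i (\<epsilon> * int l) u - vscale V (\<Psi>' \<epsilon> i l) u"
    by (simp add: v' algebra_simps scale_right_distrib scale_left_diff_distrib)
  also have "\<dots> \<in> v.proper_span"
    using phi[OF u] u subsp by (simp add: subspace_diff subspace_scale)
  finally have mem: "vscale V (c * (\<Psi>' \<epsilon> i l - \<Psi> \<epsilon> i l)) v \<in> v.proper_span" .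
  have "c = 0"
  proof (rule ccontr)
    assume "c \<noteq> 0"
    define d where "d = c * (\<Psi>' \<epsilon> i l - \<Psi> \<epsilon> i l)"
    have "d \<noteq> 0" using \<open>c \<noteq> 0\<close> neq by (simp add: d_def)
    then have "v \<in> v.proper_span"
      using subspace_scale[OF subsp mem[folded d_def], of "inverse d"] by simp
    then show False using v.v_notin_proper_span by simp
  qed
  then have "v' \<in> v.proper_span" using u v' by simp
  have "w \<in> v.proper_span" if "lowering_word V n v' k w" for k w
    using that by (induction rule: lowering_word.induct) (auto intro: lower \<open>v' \<in> v.proper_span\<close>)
  then have "span (\<Union>k. v'.words k) \<subseteq> v.proper_span"
    using subsp by (intro span_minimal) auto
  then show False
    using v'.words_span_UNIV[OF assms(3)] v.v_notin_proper_span by auto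
qed

section \<open>The \<open>\<ell>\<close>-weight determines the monomial\<close>

text \<open>The factor \<open>1 - a q^r u\<close> that the variable \<open>Y_{i,r}\<close> contributes to the \<open>i\<close>-th Drinfeld polynomial.\<close>

definition lin_factor :: "complex \<Rightarrow> complex \<Rightarrow> int \<Rightarrow> complex poly" where
  "lin_factor q a r = [:1, - (a * q powi r):]"

text \<open>The multiset of all \<open>r\<close> such that \<open>Y_{i,r}\<close> occurs in \<open>m\<close>, for a fixed \<open>i\<close>.\<close>

definition row :: "monomial \<Rightarrow> nat \<Rightarrow> int multiset" where
  "row m i = image_mset snd (filter_mset (\<lambda>x. fst x = i) m)"

lemma count_row: "count (row m i) r = count m (i, r)"
proof (induction m)
  case (add x m)
  then show ?case by (cases x) (auto simp: row_def)
qed (simp add: row_def)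

text \<open>
  The hypothesis says that the difference of the two multiplicity functions has period 2; it
  vanishes because its support is finite.
\<close>

lemma shift_cancel:
  fixes R R' :: "int multiset"
  assumes "\<And>t. count R (t + 1) + count R' (t - 1) = count R' (t + 1) + count R (t - 1)"
  shows "R = R'"
proof (rule multiset_eqI)
  fix t
  define f where "f s = int (count R s) - int (count R' s)" for s
  have per: "f (s + 2) = f s" for s using assms[of "s + 1"] by (simp add: f_def add.commute)
  have f: "f (t + 2 * int k) = f t" for k
  proof (induction k)
    case (Suc k)
    then show ?case using per[of "t + 2 * int k"] by (simp add: algebra_simps)
  qed simp
  have "finite (set_mset R \<union> set_mset R')" by simp
  moreover have "infinite (range (\<lambda>k. t + 2 * int k))"
    by (intro range_inj_infinite injI) auto
  ultimately obtain k where "t + 2 * int k \<notin> set_mset R \<union> set_mset R'"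
    by (meson finite_subset image_subsetI)
  then have "f (t + 2 * int k) = 0" by (simp add: f_def not_in_iff)
  then show "count R t = count R' t" using f[of k] by (simp add: f_def)
qed

context
  fixes q a :: complex
  assumes q: "q \<noteq> 0" "\<And>k. 0 < k \<Longrightarrow> q ^ k \<noteq> 1" and a: "a \<noteq> 0"
begin

lemma powi_inj:
  assumes "q powi r = q powi s" shows "r = s"
proof -
  have *: "r = s" if "q powi r = q powi s" "r \<le> s" for r s
  proof (rule ccontr)
    assume "r \<noteq> s"
    have "q powi (s - r) = 1" using that q by (simp add: power_int_diff)
    then have "q ^ nat (s - r) = 1" using that by (simp add: power_int_def)
    then show False using q(2)[of "nat (s - r)"] that \<open>r \<noteq> s\<close> by simp
  qed
  show ?thesis using *[of r s] *[of s r] assms by (cases "r \<le> s") auto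
qed

lemma order_lin_factor: "order (inverse (a * q powi t)) (lin_factor q a r) = (if r = t then 1 else 0)"
proof (cases "r = t")
  case True
  define x where "x = a * q powi t"
  have "x \<noteq> 0" using a q(1) by (simp add: x_def)
  then have "lin_factor q a r = smult (- x) [:- inverse x, 1:]"
    using True by (simp add: lin_factor_def x_def[symmetric])
  then have "order (inverse x) (lin_factor q a r) = 1"
    using \<open>x \<noteq> 0\<close> order_power_n_n[of "inverse x" 1] order_smult[of "- x" "inverse x" "[:- inverse x, 1:]"]
    by simp
  then show ?thesis using True by (simp add: x_def)
next
  case False
  have "poly (lin_factor q a r) (inverse (a * q powi t)) = 1 - q powi r / q powi t"
    using a by (simp add: lin_factor_def field_simps)
  also have "\<dots> \<noteq> 0" using False powi_inj q by auto
  finally show ?thesis using False by (simp add: order_0I)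
qed

lemma order_lin_factor_prod:
  "order (inverse (a * q powi t)) (\<Prod>r\<in>#R. lin_factor q a (r + s)) = count R (t - s)"
proof (induction R)
  case (add r R)
  have "(\<Prod>r\<in>#R. lin_factor q a (r + s)) \<noteq> 0" "lin_factor q a (r + s) \<noteq> 0"
    by (auto simp: lin_factor_def)
  then have "order (inverse (a * q powi t)) (lin_factor q a (r + s) * (\<Prod>r\<in>#R. lin_factor q a (r + s)))
     = (if r + s = t then 1 else 0) + count R (t - s)"
    using add by (simp add: order_mult order_lin_factor del: inverse_mult_distrib)
  then show ?case by auto
qed simp

lemma lin_factor_shift: "pcompose (lin_factor q a r) [:0, q powi s:] = lin_factor q a (r + s)"
  using q by (simp add: lin_factor_def pcompose_pCons power_int_add)

lemma pcompose_lin_factor_prod: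
  "pcompose (\<Prod>r\<in>#R. lin_factor q a r) [:0, q powi s:] = (\<Prod>r\<in>#R. lin_factor q a (r + s))"
  by (induction R) (simp_all add: pcompose_mult lin_factor_shift pcompose_1)

lemma degree_lin_factor_prod: "degree (\<Prod>r\<in>#R. lin_factor q a r) = size R"
proof (induction R)
  case (add r R)
  have "(\<Prod>r\<in>#R. lin_factor q a r) \<noteq> 0" "lin_factor q a r \<noteq> 0"
    by (auto simp: lin_factor_def)
  then have "degree (lin_factor q a r * (\<Prod>r\<in>#R. lin_factor q a r)) = 1 + size R"
    using add a q by (simp add: degree_mult_eq) (simp add: lin_factor_def)
  then show ?case by simp
qed simp

lemma coeff_lin_factor_prod_0: "coeff (\<Prod>r\<in>#R. lin_factor q a (r + s)) 0 = 1"
  by (induction R) (simp_all add: coeff_mult_0 lin_factor_def)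

lemma drinfeld_poly_row: "drinfeld_poly q a m i = (\<Prod>r\<in>#row m i. lin_factor q a r)"
proof (induction m)
  case (add x m)
  then show ?case by (cases x) (auto simp: drinfeld_poly_def row_def lin_factor_def)
qed (simp add: drinfeld_poly_def row_def)

lemma lweight_series_row:
  "lweight_series q a m 1 i = fps_const (q ^ size (row m i)) *
     (fps_of_poly (\<Prod>r\<in>#row m i. lin_factor q a (r - 1)) / fps_of_poly (\<Prod>r\<in>#row m i. lin_factor q a (r + 1)))"
  using pcompose_lin_factor_prod[of "row m i" "-1"] pcompose_lin_factor_prod[of "row m i" 1]
  by (simp add: lweight_series_def drinfeld_poly_row degree_lin_factor_prod Let_def power_int_minus)

text \<open>
  Evaluation at \<open>u = 0\<close> shows that the Drinfeld polynomials have the same degree. After cancelling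
  the powers of \<open>q\<close> and clearing denominators, the orders of vanishing at \<open>(a q^t)^{-1}\<close> are compared.
\<close>

lemma lweight_series_row_eq:
  assumes "lweight_series q a m 1 i = lweight_series q a m' 1 i"
  shows "row m i = row m' i"
proof -
  define P where "P R s = (\<Prod>r\<in>#R. lin_factor q a (r + s))" for R s
  have P0: "fps_nth (fps_of_poly (P R s)) 0 = 1" for R s
    by (simp add: P_def coeff_lin_factor_prod_0)
  then have inv: "inverse (fps_of_poly (P R s)) * fps_of_poly (P R s) = 1" for R s
    by (intro inverse_mult_eq_1) simp
  have div: "fps_of_poly (P R s) / fps_of_poly (P R t)
      = fps_of_poly (P R s) * inverse (fps_of_poly (P R t))" for R s t
    using P0[of R t] by (intro fps_divide_unit) simp
  let ?R = "row m i" and ?R' = "row m' i"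
  have eq: "fps_const (q ^ size ?R) * (fps_of_poly (P ?R (-1)) * inverse (fps_of_poly (P ?R 1)))
     = fps_const (q ^ size ?R') * (fps_of_poly (P ?R' (-1)) * inverse (fps_of_poly (P ?R' 1)))"
    using assms unfolding lweight_series_row div[symmetric] by (simp add: P_def)
  have "q ^ size ?R = q ^ size ?R'"
    using arg_cong[OF eq, of "\<lambda>f. fps_nth f 0"] by (simp add: P0 del: fps_of_poly_nth)
  then have "fps_of_poly (P ?R (-1)) * inverse (fps_of_poly (P ?R 1))
     = fps_of_poly (P ?R' (-1)) * inverse (fps_of_poly (P ?R' 1))"
    using eq q by (simp add: fps_const_eq_0_iff)
  then have "fps_of_poly (P ?R (-1)) * (inverse (fps_of_poly (P ?R 1)) * fps_of_poly (P ?R 1)) * fps_of_poly (P ?R' 1)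
     = fps_of_poly (P ?R' (-1)) * (inverse (fps_of_poly (P ?R' 1)) * fps_of_poly (P ?R' 1)) * fps_of_poly (P ?R 1)"
    by (auto simp: inv dest: arg_cong[where f = "\<lambda>x. x * (fps_of_poly (P ?R 1) * fps_of_poly (P ?R' 1))"] simp: ac_simps)
  then have "fps_of_poly (P ?R (-1) * P ?R' 1) = fps_of_poly (P ?R' (-1) * P ?R 1)"
    by (simp add: inv fps_of_poly_mult)
  then have *: "P ?R (-1) * P ?R' 1 = P ?R' (-1) * P ?R 1"
    by (simp only: fps_of_poly_eq_iff)
  have nz: "P R s \<noteq> 0" for R s
    using coeff_lin_factor_prod_0[of s R] unfolding P_def by (metis coeff_0 zero_neq_one)
  have "order (inverse (a * q powi t)) (P R s) = count R (t - s)" for R s t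
    using order_lin_factor_prod by (simp add: P_def)
  then have "count ?R (t + 1) + count ?R' (t - 1) = count ?R' (t + 1) + count ?R (t - 1)" for t
    using arg_cong[OF *, of "order (inverse (a * q powi t))"] by (simp add: order_mult nz)
  then show ?thesis by (rule shift_cancel)
qed

lemma lweight_series_inj:
  assumes "dominant_monomial n m" "dominant_monomial n m'"
    and "\<And>i. i \<in> {1..n} \<Longrightarrow> lweight_series q a m 1 i = lweight_series q a m' 1 i"
  shows "m = m'"
proof (rule multiset_eqI)
  fix x :: "nat \<times> int"
  obtain i r where x: "x = (i, r)" by (cases x)
  show "count m x = count m' x"
  proof (cases "i \<in> {1..n}")
    case True
    then show ?thesis using lweight_series_row_eq[OF assms(3)[OF True]] count_row x by metis
  next
    case False
    then have "x \<notin># m" "x \<notin># m'" using assms(1,2) x by (auto simp: dominant_monomial_def)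
    then show ?thesis by (simp add: not_in_iff)
  qed
qed

end

section \<open>Alternating sequences and height functions\<close>

text \<open>
  Sequences \<open>(i 1, b 1), \<dots>, (i k, b k)\<close> with increasing first entries, whose second entries go up and
  down alternately, by the difference of the first entries plus 2.
\<close>

definition zigzag :: "nat \<Rightarrow> (nat \<Rightarrow> nat) \<Rightarrow> (nat \<Rightarrow> int) \<Rightarrow> bool" where
  "zigzag k i b \<longleftrightarrow> strict_mono_on {1..k} i \<and>
       (\<forall>j. 2 \<le> j \<and> j \<le> k - 1 \<longrightarrow> (b j - b (j - 1)) * (b (j + 1) - b j) < 0) \<and>
       (\<forall>j. 2 \<le> j \<and> j \<le> k \<longrightarrow> \<bar>b j - b (j - 1)\<bar> = int (i j) - int (i (j - 1)) + 2)"

text \<open>The product of the \<open>Y_{i_j, b_j}\<close>, in additive notation.\<close>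

definition zigzag_monomial :: "nat \<Rightarrow> (nat \<Rightarrow> nat) \<Rightarrow> (nat \<Rightarrow> int) \<Rightarrow> monomial" where
  "zigzag_monomial k i b = (\<Sum>j\<in>{1..k}. Y (i j) (b j))"

lemma zigzag_monomial_cong:
  "(\<And>j. j \<in> {1..k} \<Longrightarrow> i j = i' j \<and> b j = b' j) \<Longrightarrow> zigzag_monomial k i b = zigzag_monomial k i' b'"
  by (simp add: zigzag_monomial_def)

lemma zigzag_monomial_Suc:
  "zigzag_monomial (Suc k) i b = zigzag_monomial k i b + Y (i (Suc k)) (b (Suc k))"
  by (simp add: zigzag_monomial_def)

lemma strict_mono_on_Suc:
  fixes i :: "nat \<Rightarrow> nat"
  shows "strict_mono_on {1..Suc k} i \<longleftrightarrow> strict_mono_on {1..k} i \<and> (1 \<le> k \<longrightarrow> i k < i (Suc k))"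
proof
  assume L: "strict_mono_on {1..k} i \<and> (1 \<le> k \<longrightarrow> i k < i (Suc k))"
  show "strict_mono_on {1..Suc k} i"
  proof (rule strict_mono_onI)
    fix r s assume rs: "r \<in> {1..Suc k}" "s \<in> {1..Suc k}" "r < s"
    show "i r < i s"
    proof (cases "s = Suc k")
      case True
      have "i r \<le> i k" using L rs True strict_mono_onD[of "{1..k}" i r k]
        by (cases "r = k") auto
      then show ?thesis using L rs True by auto
    next
      case False
      then show ?thesis using L rs by (auto intro: strict_mono_onD)
    qed
  qed
qed (auto simp: strict_mono_on_def)

lemma zigzag_Suc:
  assumes "2 \<le> k"
  shows "zigzag (Suc k) i b \<longleftrightarrow> zigzag k i b \<and> i k < i (Suc k) \<and>
     (b k - b (k - 1)) * (b (Suc k) - b k) < 0 \<and> \<bar>b (Suc k) - b k\<bar> = int (i (Suc k)) - int (i k) + 2"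
proof -
  have "2 \<le> j \<and> j \<le> Suc k - 1 \<longleftrightarrow> (2 \<le> j \<and> j \<le> k - 1) \<or> j = k" for j
    using assms by auto
  then have 1: "(\<forall>j. 2 \<le> j \<and> j \<le> Suc k - 1 \<longrightarrow> P j) \<longleftrightarrow> (\<forall>j. 2 \<le> j \<and> j \<le> k - 1 \<longrightarrow> P j) \<and> P k" for P
    by metis
  have "2 \<le> j \<and> j \<le> Suc k \<longleftrightarrow> (2 \<le> j \<and> j \<le> k) \<or> j = Suc k" for j
    using assms by auto
  then have 2: "(\<forall>j. 2 \<le> j \<and> j \<le> Suc k \<longrightarrow> P j) \<longleftrightarrow> (\<forall>j. 2 \<le> j \<and> j \<le> k \<longrightarrow> P j) \<and> P (Suc k)" for P
    by metis
  show ?thesis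
    using assms unfolding zigzag_def strict_mono_on_Suc 1 2 by auto
qed

lemma zigzag_2:
  "zigzag 2 i b \<longleftrightarrow> i 1 < i 2 \<and> \<bar>b 2 - b 1\<bar> = int (i 2) - int (i 1) + 2"
proof -
  have "{1..2} = {1, 2::nat}" by auto
  moreover have "(\<forall>j. 2 \<le> j \<and> j \<le> (2::nat) \<longrightarrow> P j) \<longleftrightarrow> P 2" for P
    by (metis le_antisym order_refl)
  ultimately show ?thesis by (auto simp: zigzag_def strict_mono_on_def)
qed

text \<open>The second index of the factor of \<open>\<omega>(i,j)\<close> at a position \<open>p > i\<close>.\<close>

definition omega_level :: "(nat \<Rightarrow> int) \<Rightarrow> nat \<Rightarrow> int" where
  "omega_level \<xi> p = (if \<xi> p = \<xi> (p - 1) + 1 then \<xi> p + 1 else \<xi> p - 1)"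

text \<open>
  All factors of \<open>\<omega>(i,j)\<close> but the last one: unlike \<open>\<omega>(i,j)\<close> itself, this part only grows with \<open>j\<close>.
\<close>

definition omega_front :: "(nat \<Rightarrow> int) \<Rightarrow> nat \<Rightarrow> nat \<Rightarrow> monomial" where
  "omega_front \<xi> i j = Y i (if \<xi> (i + 1) = \<xi> i - 1 then \<xi> i + 1 else \<xi> i - 1)
     + (\<Sum>p\<in>{p. i < p \<and> p < j \<and> \<xi> (p - 1) = \<xi> (p + 1)}. Y p (omega_level \<xi> p))"

lemma omega_eq_front: "omega \<xi> i j = omega_front \<xi> i j + Y j (omega_level \<xi> j)"
  by (simp add: omega_def omega_front_def omega_level_def add.commute add.left_commute)

lemma omega_front_Suc:
  assumes "i < j"
  shows "omega_front \<xi> i (Suc j) =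
    (if \<xi> (j - 1) = \<xi> (j + 1) then omega_front \<xi> i j + Y j (omega_level \<xi> j) else omega_front \<xi> i j)"
proof (cases "\<xi> (j - 1) = \<xi> (j + 1)")
  case True
  with assms have "{p. i < p \<and> p < Suc j \<and> \<xi> (p - 1) = \<xi> (p + 1)}
    = insert j {p. i < p \<and> p < j \<and> \<xi> (p - 1) = \<xi> (p + 1)}" by (auto simp: less_Suc_eq)
  with True show ?thesis by (simp add: omega_front_def)
next
  case False
  then have "{p. i < p \<and> p < Suc j \<and> \<xi> (p - 1) = \<xi> (p + 1)}
    = {p. i < p \<and> p < j \<and> \<xi> (p - 1) = \<xi> (p + 1)}" by (auto simp: less_Suc_eq)
  with False show ?thesis by (simp add: omega_front_def)
qed

lemma omega_front_base:
  "omega_front \<xi> i (Suc i) = Y i (if \<xi> (i + 1) = \<xi> i - 1 then \<xi> i + 1 else \<xi> i - 1)"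
proof -
  have "{p. i < p \<and> p < Suc i \<and> \<xi> (p - 1) = \<xi> (p + 1)} = {}" by auto
  then show ?thesis unfolding omega_front_def by (simp only: sum.empty add_0_right)
qed

lemma height_function_step:
  assumes "height_function n \<xi>" "1 < p" "p \<le> n"
  shows "\<bar>\<xi> p - \<xi> (p - 1)\<bar> = 1"
proof -
  have "\<bar>\<xi> (p - 1) - \<xi> (p - 1 + 1)\<bar> = 1"
    using assms(2,3) assms(1)[unfolded height_function_def, rule_format, of "p - 1"] by simp
  then show ?thesis using assms by (simp add: abs_minus_commute)
qed

lemma omega_level_eq:
  assumes "height_function n \<xi>" "1 < p" "p \<le> n"
  shows "omega_level \<xi> p = 2 * \<xi> p - \<xi> (p - 1)"
  using height_function_step[OF assms] by (auto simp: omega_level_def)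

text \<open>
  Induction on \<open>j\<close>. If \<open>j\<close> is a turning point of \<open>\<xi>\<close>, then passing to \<open>j + 1\<close> appends a factor with the
  opposite sign; otherwise the last factor is replaced by the one at \<open>j + 1\<close>.
\<close>

lemma omega_is_zigzag:
  assumes \<xi>: "height_function n \<xi>" and "1 \<le> i" "Suc i \<le> j" "j \<le> n"
  shows "\<exists>k p b. 2 \<le> k \<and> zigzag k p b \<and> (\<forall>l\<in>{1..k}. p l \<in> {i..j}) \<and> p k = j \<and>
    omega_front \<xi> i j = zigzag_monomial (k - 1) p b \<and> b k = omega_level \<xi> j \<and>
    b k - b (k - 1) = (\<xi> j - \<xi> (j - 1)) * (int (p k) - int (p (k - 1)) + 2)"
  using \<open>Suc i \<le> j\<close> \<open>j \<le> n\<close>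
proof (induction j rule: dec_induct)
  case base
  define \<epsilon> where "\<epsilon> = \<xi> (Suc i) - \<xi> i"
  define p where "p l = (if l = 1 then i else Suc i)" for l :: nat
  define b where "b l = (if l = 1 then \<xi> i - \<epsilon> else omega_level \<xi> (Suc i))" for l :: nat
  have e: "\<bar>\<epsilon>\<bar> = 1" using height_function_step[OF \<xi>, of "Suc i"] base assms by (simp add: \<epsilon>_def)
  have lev: "omega_level \<xi> (Suc i) = \<xi> i + 2 * \<epsilon>"
    using omega_level_eq[OF \<xi>, of "Suc i"] base assms by (simp add: \<epsilon>_def)
  have "zigzag 2 p b" using e by (simp add: zigzag_2 p_def b_def lev)
  moreover have "omega_front \<xi> i (Suc i) = zigzag_monomial (2 - 1) p b"
    using e unfolding omega_front_base zigzag_monomial_def by (auto simp: p_def b_def \<epsilon>_def)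
  moreover have "\<forall>l\<in>{1..2}. p l \<in> {i..Suc i}" "p 2 = Suc i" "b 2 = omega_level \<xi> (Suc i)"
    "b 2 - b (2 - 1) = (\<xi> (Suc i) - \<xi> (Suc i - 1)) * (int (p 2) - int (p (2 - 1)) + 2)"
    using lev by (simp_all add: p_def b_def \<epsilon>_def)
  ultimately show ?case by blast
next
  case (step j)
  then obtain k p b where IH: "2 \<le> k" "zigzag k p b" "\<forall>l\<in>{1..k}. p l \<in> {i..j}" "p k = j"
    "omega_front \<xi> i j = zigzag_monomial (k - 1) p b" "b k = omega_level \<xi> j"
    "b k - b (k - 1) = (\<xi> j - \<xi> (j - 1)) * (int (p k) - int (p (k - 1)) + 2)" by auto
  define \<epsilon> where "\<epsilon> = \<xi> j - \<xi> (j - 1)"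
  define \<epsilon>' where "\<epsilon>' = \<xi> (Suc j) - \<xi> j"
  have e: "\<bar>\<epsilon>\<bar> = 1" "\<bar>\<epsilon>'\<bar> = 1"
    using height_function_step[OF \<xi>, of j] height_function_step[OF \<xi>, of "Suc j"] step assms
    by (simp_all add: \<epsilon>_def \<epsilon>'_def)
  have lev: "omega_level \<xi> j = \<xi> j + \<epsilon>" "omega_level \<xi> (Suc j) = \<xi> j + 2 * \<epsilon>'"
    using omega_level_eq[OF \<xi>, of j] omega_level_eq[OF \<xi>, of "Suc j"] step assms
    by (simp_all add: \<epsilon>_def \<epsilon>'_def)
  obtain k' where k: "k = Suc k'" "1 \<le> k'" using IH(1) by (cases k) auto
  have pk': "p k' < p k" using IH(2) k by (auto simp: zigzag_def strict_mono_on_def)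
  show ?case
  proof (cases "\<xi> (j - 1) = \<xi> (j + 1)")
    case True
    then have e': "\<epsilon>' = - \<epsilon>" by (simp add: \<epsilon>_def \<epsilon>'_def)
    define p' where "p' = p(Suc k := Suc j)"
    define b' where "b' = b(Suc k := omega_level \<xi> (Suc j))"
    have diff: "b' (Suc k) - b' k = 3 * \<epsilon>'" using IH(6) lev e' by (simp add: b'_def)
    have "(b k - b (k - 1)) * (3 * \<epsilon>') < 0"
      using e pk' k IH(7)[folded \<epsilon>_def] e' by (auto simp: abs_if mult_less_0_iff split: if_splits)
    moreover have "zigzag k p' b'"
      using IH(2) unfolding zigzag_def p'_def b'_def by (auto simp: strict_mono_on_def)
    ultimately have "zigzag (Suc k) p' b'"
      unfolding zigzag_Suc[OF IH(1)] diff using e IH(4) k by (simp add: p'_def b'_def)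
    moreover have "zigzag_monomial (Suc k - 1) p' b' = zigzag_monomial k p b"
      by (auto simp: p'_def b'_def intro: zigzag_monomial_cong)
    then have "omega_front \<xi> i (Suc j) = zigzag_monomial (Suc k - 1) p' b'"
      using True step IH k omega_front_Suc[of i j \<xi>] by (simp add: zigzag_monomial_Suc)
    moreover have "b' (Suc k) - b' (Suc k - 1) = (\<xi> (Suc j) - \<xi> (Suc j - 1)) * (int (p' (Suc k)) - int (p' (Suc k - 1)) + 2)"
      using diff IH(4) by (simp add: \<epsilon>'_def p'_def)
    moreover have "2 \<le> Suc k" "\<forall>l\<in>{1..Suc k}. p' l \<in> {i..Suc j}" "p' (Suc k) = Suc j"
      "b' (Suc k) = omega_level \<xi> (Suc j)"
      using IH(1,3) step by (auto simp: p'_def b'_def le_Suc_eq)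
    ultimately show ?thesis by blast
  next
    case False
    then have e': "\<epsilon>' = \<epsilon>" using e by (auto simp: \<epsilon>_def \<epsilon>'_def)
    define p' where "p' = p(k := Suc j)"
    define b' where "b' = b(k := omega_level \<xi> (Suc j))"
    have diff: "b' k - b' (k - 1) = \<epsilon> * (int (p' k) - int (p' (k - 1)) + 2)"
      using IH(4,6) IH(7)[folded \<epsilon>_def] lev e' k by (simp add: b'_def p'_def algebra_simps)
    have sgn: "sgn (b' k - b' (k - 1)) = sgn (b k - b (k - 1))"
      using diff IH(4,7)[folded \<epsilon>_def] k pk' e by (simp add: sgn_mult p'_def)
    have "zigzag k p' b'"
    proof (cases "2 \<le> k'")
      case True
      have "zigzag k' p' b'"
        using IH(2) unfolding k zigzag_Suc[OF True] unfolding zigzag_def p'_def b'_def k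
        by (auto simp: strict_mono_on_def)
      moreover have "\<bar>b' k - b' k'\<bar> = int (p' k) - int (p' k') + 2"
        using diff k e pk' IH(4) by (simp add: abs_mult p'_def)
      moreover have "(b' k' - b' (k' - 1)) * (b' k - b' k') < 0"
      proof -
        have "k' \<noteq> k" "k' - 1 \<noteq> k" using k by arith+
        then have "b' k' = b k'" "b' (k' - 1) = b (k' - 1)" by (simp_all add: b'_def)
        then have "sgn ((b' k' - b' (k' - 1)) * (b' k - b' k')) = sgn ((b k' - b (k' - 1)) * (b k - b k'))"
          using sgn k by (simp add: sgn_mult)
        moreover have "(b k' - b (k' - 1)) * (b k - b k') < 0"
          using IH(2) zigzag_Suc[OF True, of p b] k by simp
        ultimately show ?thesis by (metis sgn_less)
      qed
      moreover have "p' k' < p' k" using IH(4) pk' k by (simp add: p'_def)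
      ultimately show ?thesis
        unfolding k zigzag_Suc[OF True] by simp
    next
      case False
      then have "k = 2" using k by simp
      then show ?thesis
        using diff e pk' IH(4) \<open>k = 2\<close> k(1)
        by (simp add: zigzag_2 abs_mult p'_def flip: numeral_2_eq_2)
    qed
    moreover have "zigzag_monomial (k - 1) p' b' = zigzag_monomial (k - 1) p b"
      using k by (intro zigzag_monomial_cong) (auto simp: p'_def b'_def)
    then have "omega_front \<xi> i (Suc j) = zigzag_monomial (k - 1) p' b'"
      using False step IH k omega_front_Suc[of i j \<xi>] by simp
    moreover have "b' k - b' (k - 1) = (\<xi> (Suc j) - \<xi> (Suc j - 1)) * (int (p' k) - int (p' (k - 1)) + 2)"
      using diff e' by (simp add: \<epsilon>'_def)
    moreover have "\<forall>l\<in>{1..k}. p' l \<in> {i..Suc j}" "p' k = Suc j" "b' k = omega_level \<xi> (Suc j)"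
      using IH(3) step by (auto simp: p'_def b'_def le_Suc_eq)
    ultimately show ?thesis using IH(1) by blast
  qed
qed

lemma omega_cong:
  assumes "i < j" "\<And>p. p \<le> j \<Longrightarrow> \<xi> p = \<xi>' p"
  shows "omega_front \<xi> i j = omega_front \<xi>' i j" "omega_level \<xi> j = omega_level \<xi>' j"
proof -
  have "{p. i < p \<and> p < j \<and> \<xi> (p - 1) = \<xi> (p + 1)} = {p. i < p \<and> p < j \<and> \<xi>' (p - 1) = \<xi>' (p + 1)}"
    using assms by auto
  then show "omega_front \<xi> i j = omega_front \<xi>' i j" "omega_level \<xi> j = omega_level \<xi>' j"
    using assms by (auto simp: omega_front_def omega_level_def intro!: sum.cong)
qed

text \<open>A stretch of \<open>\<xi>\<close> without turning points adds no factors but the one at its starting point.\<close>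

lemma omega_front_linear:
  assumes "i < j" "j \<le> l" "\<And>p. j < p \<Longrightarrow> p < l \<Longrightarrow> \<xi> (p - 1) \<noteq> \<xi> (p + 1)" "j < l \<Longrightarrow> \<xi> (j - 1) = \<xi> (j + 1)"
  shows "omega_front \<xi> i l = (if j < l then omega_front \<xi> i j + Y j (omega_level \<xi> j) else omega_front \<xi> i j)"
  using assms(2) assms(3,4)
proof (induction l rule: dec_induct)
  case (step l)
  then show ?case using assms(1) omega_front_Suc[of i l \<xi>]
    by (cases "j = l") auto
qed simp

text \<open>
  The sign \<open>\<epsilon>\<close> is the slope of \<open>\<xi>\<close> just before the last index. Appending a pair to the sequence
  changes \<open>\<xi>\<close> only to the right of \<open>p k\<close>, where it becomes linear with slope \<open>- \<epsilon>\<close>.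
\<close>

lemma zigzag_is_omega:
  assumes "2 \<le> k" "zigzag k p b"
  shows "\<exists>\<xi> \<epsilon>. (\<forall>x. \<bar>\<xi> x - \<xi> (x + 1)\<bar> = 1) \<and> \<bar>\<epsilon>\<bar> = 1 \<and> p 1 < p k \<and>
     omega \<xi> (p 1) (p k) = zigzag_monomial k p b \<and> \<xi> (p k) = b k - \<epsilon> \<and>
     \<xi> (p k) - \<xi> (p k - 1) = \<epsilon> \<and> b k - b (k - 1) = \<epsilon> * (int (p k) - int (p (k - 1)) + 2)"
  using assms
proof (induction k rule: dec_induct)
  case base
  then have *: "p 1 < p 2" "\<bar>b 2 - b 1\<bar> = int (p 2) - int (p 1) + 2" by (simp_all add: zigzag_2)
  define \<epsilon> where "\<epsilon> = sgn (b 2 - b 1)"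
  have e: "\<bar>\<epsilon>\<bar> = 1" "\<epsilon> = 1 \<or> \<epsilon> = -1" using * by (auto simp: \<epsilon>_def sgn_if)
  have b: "b 2 - b 1 = \<epsilon> * (int (p 2) - int (p 1) + 2)"
    using *(2)[symmetric] by (simp add: \<epsilon>_def sgn_mult_abs)
  \<comment> \<open>The first factor lies on the side of \<open>\<xi>\<close> opposite to its slope: \<open>b 1 = \<xi> (p 1) - \<epsilon>\<close>.\<close>
  define \<xi> where "\<xi> x = b 1 + \<epsilon> + \<epsilon> * (int x - int (p 1))" for x :: nat
  have step: "\<xi> (x + 1) = \<xi> x + \<epsilon>" for x by (simp add: \<xi>_def algebra_simps)
  have prev_level: "\<xi> (p 2 - 1) = \<xi> (p 2) - \<epsilon>" using step[of "p 2 - 1"] * by simp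
  have \<xi>2: "\<xi> (p 2) = b 2 - \<epsilon>" using b by (simp add: \<xi>_def algebra_simps)
  have "\<epsilon> \<noteq> 0" using e by auto
  have "omega_front \<xi> (p 1) (p 2) = omega_front \<xi> (p 1) (Suc (p 1))"
  proof -
    have "{x. p 1 < x \<and> x < p 2 \<and> \<xi> (x - 1) = \<xi> (x + 1)} = {}"
      "{x. p 1 < x \<and> x < Suc (p 1) \<and> \<xi> (x - 1) = \<xi> (x + 1)} = {}"
      using \<open>\<epsilon> \<noteq> 0\<close> by (auto simp: \<xi>_def)
    then show ?thesis by (simp only: omega_front_def)
  qed
  also have "\<dots> = Y (p 1) (b 1)"
    unfolding omega_front_base step using e by (auto simp: \<xi>_def)
  finally have "omega \<xi> (p 1) (p 2) = Y (p 1) (b 1) + Y (p 2) (b 2)"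
    using e(2) \<xi>2 prev_level by (auto simp: omega_eq_front omega_level_def)
  also have "\<dots> = zigzag_monomial 2 p b"
    by (simp add: zigzag_monomial_def numeral_2_eq_2)
  finally show ?case
    using * e b \<xi>2 prev_level step by (intro exI[of _ \<xi>] exI[of _ \<epsilon>]) auto
next
  case (step k)
  note zz = step.prems[unfolded zigzag_Suc[OF step.hyps(1)]]
  from step zz obtain \<xi> \<epsilon> where IH: "\<forall>x. \<bar>\<xi> x - \<xi> (x + 1)\<bar> = 1" "\<bar>\<epsilon>\<bar> = 1" "p 1 < p k"
     "omega \<xi> (p 1) (p k) = zigzag_monomial k p b" "\<xi> (p k) = b k - \<epsilon>"
     "\<xi> (p k) - \<xi> (p k - 1) = \<epsilon>" "b k - b (k - 1) = \<epsilon> * (int (p k) - int (p (k - 1)) + 2)"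
    by blast
  have e: "\<epsilon> = 1 \<or> \<epsilon> = -1" using IH(2) by auto
  have "p (k - 1) < p k"
    using zz step.hyps by (auto simp: zigzag_def strict_mono_on_def)
  then have b: "b (Suc k) - b k = - \<epsilon> * (int (p (Suc k)) - int (p k) + 2)"
    using zz IH(7) e by (auto simp: mult_less_0_iff)
  define \<xi>' where "\<xi>' x = (if x \<le> p k then \<xi> x else \<xi> (p k) - \<epsilon> * (int x - int (p k)))" for x :: nat
  have lin: "\<xi>' x = \<xi> (p k) - \<epsilon> * (int x - int (p k))" if "p k \<le> x" for x
    using that by (auto simp: \<xi>'_def)
  have h: "\<bar>\<xi>' x - \<xi>' (x + 1)\<bar> = 1" for x
  proof (cases "x < p k")
    case True
    then show ?thesis using IH(1) by (simp add: \<xi>'_def)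
  next
    case False
    then show ?thesis using lin[of x] lin[of "x + 1"] e by auto
  qed
  let ?l = "p (Suc k)"
  have lt: "p k < ?l" using zz by simp
  have prev_level: "\<xi>' (?l - 1) = \<xi>' ?l + \<epsilon>" "\<xi>' ?l = b (Suc k) + \<epsilon>"
  proof -
    have "p k \<le> ?l - 1" "int (?l - 1) = int ?l - 1" using lt by auto
    then show "\<xi>' (?l - 1) = \<xi>' ?l + \<epsilon>"
      using lin[of "?l - 1"] lin[of ?l] lt by (simp add: algebra_simps)
    show "\<xi>' ?l = b (Suc k) + \<epsilon>"
      using lin[of ?l] lt b IH(5) by (simp add: algebra_simps)
  qed
  have "omega_front \<xi>' (p 1) ?l = omega_front \<xi>' (p 1) (p k) + Y (p k) (omega_level \<xi>' (p k))"
  proof -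
    have "\<xi>' (x - 1) \<noteq> \<xi>' (x + 1)" if "p k < x" for x
      using lin[of "x - 1"] lin[of "x + 1"] that e by (auto simp: of_nat_diff)
    moreover have "\<xi>' (p k - 1) = \<xi>' (p k + 1)"
      using lin[of "p k + 1"] IH(6) by (simp add: \<xi>'_def)
    ultimately show ?thesis using omega_front_linear[OF IH(3), of ?l \<xi>'] lt by simp
  qed
  also have "\<dots> = omega_front \<xi> (p 1) (p k) + Y (p k) (omega_level \<xi> (p k))"
    using omega_cong[OF IH(3), of \<xi>' \<xi>] by (simp add: \<xi>'_def)
  also have "\<dots> = zigzag_monomial k p b" using IH(4) by (simp add: omega_eq_front)
  finally have "omega \<xi>' (p 1) ?l = zigzag_monomial (Suc k) p b"
    using e prev_level by (auto simp: omega_eq_front zigzag_monomial_Suc omega_level_def)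
  then show ?case
    using h e prev_level b lt IH(3) by (intro exI[of _ \<xi>'] exI[of _ "- \<epsilon>"]) auto
qed

lemma Pr_iff_zigzag:
  "(\<exists>\<xi>. height_function n \<xi> \<and> m \<in> Pr n \<xi>) \<longleftrightarrow>
   (\<exists>k i b. 1 \<le> k \<and> (\<forall>j\<in>{1..k}. i j \<in> {1..n}) \<and> m = zigzag_monomial k i b \<and> zigzag k i b)"
  (is "?L \<longleftrightarrow> ?R")
proof
  assume ?L
  then obtain \<xi> where \<xi>: "height_function n \<xi>" and "m \<in> Pr n \<xi>" by blast
  then consider (var) i r where "i \<in> {1..n}" "m = Y i r"
    | (omega) i j where "1 \<le> i" "i < j" "j \<le> n" "m = omega \<xi> i j"
    unfolding Pr_def by blast
  then show ?R
  proof cases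
    case var
    have "zigzag 1 (\<lambda>_. i) (\<lambda>_. r)" by (auto simp: zigzag_def strict_mono_on_def)
    moreover have "m = zigzag_monomial 1 (\<lambda>_. i) (\<lambda>_. r)"
      using var by (simp add: zigzag_monomial_def)
    ultimately show ?thesis using var(1) by (metis order_refl)
  next
    case omega
    then obtain k p b where "2 \<le> k" "zigzag k p b" "\<forall>l\<in>{1..k}. p l \<in> {i..j}" "p k = j"
      "omega_front \<xi> i j = zigzag_monomial (k - 1) p b" "b k = omega_level \<xi> j"
      using omega_is_zigzag[OF \<xi>, of i j] by auto
    moreover from this have "m = zigzag_monomial k p b"
      using omega zigzag_monomial_Suc[of "k - 1" p b] by (simp add: omega_eq_front)
    ultimately show ?thesis using omega
      by (intro exI[of _ k] exI[of _ p] exI[of _ b]) fastforce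
  qed
next
  assume ?R
  then obtain k p b where R: "1 \<le> k" "\<forall>j\<in>{1..k}. p j \<in> {1..n}" "m = zigzag_monomial k p b" "zigzag k p b"
    by blast
  show ?L
  proof (cases "k = 1")
    case True
    define \<xi> where "\<xi> x = b 1 + 1 + (int x - int (p 1))" for x :: nat
    have "m = Y (p 1) (\<xi> (p 1) - 1)" "p 1 \<in> {1..n}"
      using R True by (simp_all add: zigzag_monomial_def \<xi>_def)
    then have "m \<in> Pr n \<xi>" unfolding Pr_def by blast
    moreover have "height_function n \<xi>" by (simp add: height_function_def \<xi>_def)
    ultimately show ?thesis by blast
  next
    case False
    then have "2 \<le> k" using R(1) by simp
    with zigzag_is_omega[OF this R(4)] R(3) obtain \<xi> where
      "\<forall>x. \<bar>\<xi> x - \<xi> (x + 1)\<bar> = 1" "p 1 < p k" "m = omega \<xi> (p 1) (p k)" by metis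
    moreover have "p 1 \<in> {1..n}" "p k \<in> {1..n}" using R(1,2) by auto
    ultimately show ?thesis unfolding height_function_def Pr_def by fastforce
  qed
qed

lemma Pr_dominant:
  assumes "m \<in> Pr n \<xi>" shows "dominant_monomial n m"
proof -
  have "set_mset (omega \<xi> i j) \<subseteq> {i..j} \<times> UNIV" if "i < j" for i j
  proof -
    have "finite ({p. i < p \<and> p < j \<and> \<xi> (p - 1) = \<xi> (p + 1)} \<union> {j})" by simp
    then show ?thesis using that by (auto simp: omega_def set_mset_sum)
  qed
  then show ?thesis using assms unfolding Pr_def dominant_monomial_def by fastforce
qed

section \<open>Monomials of simple modules\<close>

lemma is_L_monomial_unique:
  assumes "is_L n q a m V" "is_L n q a m' V" "dominant_monomial n m" "dominant_monomial n m'"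
    and q: "q \<noteq> 0" "\<forall>k>0. q ^ k \<noteq> 1" and a: "a \<noteq> 0"
  shows "m = m'"
proof -
  interpret uq_affine_module V n q using assms(1) by (simp add: is_L_def)
  have high: "\<exists>v. highest_weight_vector V n q v (\<lambda>\<epsilon> i. fps_nth (lweight_series q a m \<epsilon> i))"
    if "is_L n q a m V" for m
  proof -
    obtain v where v: "highest_lweight_vector n q a m V v" using \<open>is_L n q a m V\<close> by (auto simp: is_L_def)
    have "highest_weight_vector V n q v (\<lambda>\<epsilon> i. fps_nth (lweight_series q a m \<epsilon> i))"
      using v q by unfold_locales (auto simp: highest_lweight_vector_def)
    then show ?thesis by blast
  qed
  obtain v v' where "highest_weight_vector V n q v (\<lambda>\<epsilon> i. fps_nth (lweight_series q a m \<epsilon> i))"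
    "highest_weight_vector V n q v' (\<lambda>\<epsilon> i. fps_nth (lweight_series q a m' \<epsilon> i))"
    using high assms(1,2) by blast
  moreover have "simple_module" using assms(1) by (simp add: is_L_def)
  ultimately have "fps_nth (lweight_series q a m 1 i) l = fps_nth (lweight_series q a m' 1 i) l"
    if "i \<in> {1..n}" for i l
    using lweight_unique[of v _ v' _ 1 i l] that by blast
  then show ?thesis
    using q a by (intro lweight_series_inj[of q a n m m'] assms(3,4) fps_ext) auto
qed

theorem theorem1p1:
  fixes n :: nat and q a :: complex and m :: monomial
    and V :: "('v::ab_group_add) uq_operators"
  assumes "1 \<le> n"
    and "q \<noteq> 0" and "\<forall>k>0. q ^ k \<noteq> 1"
    and "a \<noteq> 0"
    and "dominant_monomial n m"
    and "is_L n q a m V"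
  shows "(\<exists>\<xi>. height_function n \<xi> \<and> HL_cluster_module n q a \<xi> V) \<longleftrightarrow>
    (\<exists>(k::nat) (i :: nat \<Rightarrow> nat) (b :: nat \<Rightarrow> int).
       1 \<le> k \<and> (\<forall>j\<in>{1..k}. i j \<in> {1..n}) \<and>
       m = (\<Sum>j\<in>{1..k}. Y (i j) (b j)) \<and>
       strict_mono_on {1..k} i \<and>
       (\<forall>j. 2 \<le> j \<and> j \<le> k - 1 \<longrightarrow> (b j - b (j - 1)) * (b (j + 1) - b j) < 0) \<and>
       (\<forall>j. 2 \<le> j \<and> j \<le> k \<longrightarrow> \<bar>b j - b (j - 1)\<bar> = int (i j) - int (i (j - 1)) + 2))"
proof -
  have "(\<exists>\<xi>. height_function n \<xi> \<and> HL_cluster_module n q a \<xi> V)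
      \<longleftrightarrow> (\<exists>\<xi>. height_function n \<xi> \<and> m \<in> Pr n \<xi>)"
    using assms is_L_monomial_unique[of n q a m V] Pr_dominant
    unfolding HL_cluster_module_def by blast
  then show ?thesis
    unfolding Pr_iff_zigzag zigzag_monomial_def zigzag_def by simp
qed

end
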